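(* Let $\alpha\ne0$ and assume conditions (eConv), (uUE) and (uEquiv) stated in the context. Then for each $u\in\mathcal U$ and $x\in E$, $$I_x^{\alpha,2^{-m}}(u)\to I_x^{\alpha}(u)\quad\text{as } m\to\infty.$$
   Context: Setting. $E$ is a Polish space with Borel $\sigma$-field $\mathcal E$, $U$ is a compact set of control parameters, and $\mathcal U$ is a family of Borel measurable maps $u:E\to U$ (Markov controls). For each $u\in\mathcal U$, $(X_t^u)_{t\ge 0}$ is a continuous time $E$-valued Markov process with transition operators $P_t^u(x,dy)$ (the control used at time $t$ is $u(X_t^u)$). For $m\in\mathbb N$ and $a\in U$ there is a transition kernel $P^{(m),a}_{2^{-m}}(x,dy)$ on $E$ (discretization step $2^{-m}$), and $(X^{(m),u}_{n2^{-m}})_{n\ge 0}$ is the Markov chain with one-step kernel $P^{(m),u(x)}_{2^{-m}}(x,dy)$; for $t=k2^{-m}$, $P_t^{(m),u}(x,dy)$ denotes its $k$-step kernel. $E_x^u$ denotes expectation for the process started at $x$ under control $u$. The reward $c:E\times U\to\mathbb R$ is bounded, measurable and continuous in the second variable. Functionals. $$I_x^\alpha(u)=\liminf_{t\to\infty}\frac1\alpha\frac1t\ln E_x^u\Big\{e^{\alpha\int_0^tc(X_s^u,u(X_s^u))ds}\Big\},\qquad I_x^{\alpha,h}(u)=\liminf_{n\to\infty}\frac1\alpha\frac1{nh}\ln E_x^u\Big\{e^{\alpha h\sum_{i=0}^{n-1}c(X^{(m),u}_{ih},u(X^{(m),u}_{ih}))}\Big\},\quad h=2^{-m}.$$ Conditions.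 (uUE) For each $u\in\mathcal U$: $\Delta_u:=\sup_{m\in\mathbb N}\sup_{x,x'\in E}\sup_{B\in\mathcal E}\big(P_1^{(m),u}(x,B)-P_1^{(m),u}(x',B)\big)<1$. (uEquiv) For each $u\in\mathcal U$ there is $k\in\mathbb N$ such that $K_u:=\sup_{m\in\mathbb N}\sup_{x,x'\in E}\sup_{B\in\mathcal E}\frac{P_k^{(m),u}(x,B)}{P_k^{(m),u}(x',B)}<\infty$ (i.e. $P_k^{(m),u}(x,B)\le K_uP_k^{(m),u}(x',B)$ always). (eConv) For each $u\in\mathcal U$ and $x\in E$, the measures $\mathcal M_x^{(m),u,\alpha}(B):=E_x^u\{\exp\{\alpha\sum_{i=0}^{2^m-1}2^{-m}c(X^{(m),u}_{i2^{-m}},u(X^{(m),u}_{i2^{-m}}))\}1_B(X_1^{(m),u})\}$, $B\in\mathcal E$, converge in variation norm, as $m\to\infty$, to the measure $\mathcal M_x^{u,\alpha}(B):=E_x^u\{\exp\{\alpha\int_0^1c(X_s^u,u(X_s^u))ds\}1_B(X_1^u)\}$. *)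

theory Defs
  imports "HOL-Probability.Probability"
begin

definition natural_filtration ::
  "'w measure \<Rightarrow> ('t::{linorder, zero} \<Rightarrow> 'w \<Rightarrow> 'e::topological_space) \<Rightarrow> 't \<Rightarrow> 'w measure" where
  "natural_filtration M X s =
     sigma (space M) {X r -` B \<inter> space M | r B. 0 \<le> r \<and> r \<le> s \<and> B \<in> sets borel}"

text \<open>
  Under the probability measure \<open>M\<close>, the process \<open>X\<close> is a Markov process with transition
  operators \<open>P\<close>, started at \<open>x\<close>. The time set is the nonnegative part of the ordered type of
  times; it is used with real time and with natural number time (Markov chains).
\<close>

definition markov_process ::
  "('t::linordered_semidom \<Rightarrow> 'e \<Rightarrow> 'e::topological_space measure) \<Rightarrow> 'e \<Rightarrow>
   'w measure \<Rightarrow> ('t \<Rightarrow> 'w \<Rightarrow> 'e) \<Rightarrow> bool" where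
  "markov_process P x M X \<longleftrightarrow>
     prob_space M \<and>
     (\<forall>t\<ge>0. X t \<in> M \<rightarrow>\<^sub>M borel) \<and>
     (AE \<omega> in M. X 0 \<omega> = x) \<and>
     (\<forall>s\<ge>0. \<forall>t\<ge>0. \<forall>B\<in>sets borel.
        AE \<omega> in M. real_cond_exp M (natural_filtration M X s) (\<lambda>\<omega>. indicator B (X (s + t) \<omega>)) \<omega>
                     = measure (P t (X s \<omega>)) B)"

primrec kernel_power ::
  "('e \<Rightarrow> 'e measure) \<Rightarrow> nat \<Rightarrow> 'e \<Rightarrow> 'e::topological_space measure" where
  "kernel_power K 0 x = return borel x"
| "kernel_power K (Suc n) x = K x \<bind> kernel_power K n"

text \<open>
  \<open>Q m a\<close> is the transition kernel for the discretization step \<open>1 / 2 ^ m\<close> under the constant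
  control \<open>a\<close>; a Markov control \<open>u\<close> selects the control \<open>u x\<close> in the state \<open>x\<close>.
\<close>

definition controlled_kernel ::
  "(nat \<Rightarrow> 'a \<Rightarrow> 'e \<Rightarrow> 'e measure) \<Rightarrow> nat \<Rightarrow> ('e \<Rightarrow> 'a) \<Rightarrow> 'e \<Rightarrow> 'e measure" where
  "controlled_kernel Q m u x = Q m (u x) x"

text \<open>The kernel at the integer time \<open>k\<close>, i.e. after \<open>k * 2 ^ m\<close> steps.\<close>

definition discrete_transition ::
  "(nat \<Rightarrow> 'a \<Rightarrow> 'e \<Rightarrow> 'e measure) \<Rightarrow> nat \<Rightarrow> ('e \<Rightarrow> 'a) \<Rightarrow> nat \<Rightarrow> 'e \<Rightarrow> 'e::topological_space measure" where
  "discrete_transition Q m u k = kernel_power (controlled_kernel Q m u) (k * 2 ^ m)"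

text \<open>
  In the functionals below, \<open>M\<close> is the law under which the process starts at the given point.
  A discrete process is indexed by the number of steps, so \<open>Y i\<close> is its state at time \<open>i * h\<close>.
\<close>

definition I_cont ::
  "real \<Rightarrow> ('e \<Rightarrow> 'a \<Rightarrow> real) \<Rightarrow> ('e \<Rightarrow> 'a) \<Rightarrow> 'w measure \<Rightarrow> (real \<Rightarrow> 'w \<Rightarrow> 'e) \<Rightarrow> ereal" where
  "I_cont \<alpha> c u M X =
     Liminf at_top (\<lambda>t. ereal (1 / \<alpha> * (1 / t) *
       ln (LINT \<omega>|M. exp (\<alpha> * (LBINT s:{0..t}. c (X s \<omega>) (u (X s \<omega>)))))))"

definition I_disc ::
  "real \<Rightarrow> ('e \<Rightarrow> 'a \<Rightarrow> real) \<Rightarrow> real \<Rightarrow> ('e \<Rightarrow> 'a) \<Rightarrow> 'w measure \<Rightarrow> (nat \<Rightarrow> 'w \<Rightarrow> 'e) \<Rightarrow> ereal" where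
  "I_disc \<alpha> c h u M Y =
     liminf (\<lambda>n. ereal (1 / \<alpha> * (1 / (real n * h)) *
       ln (LINT \<omega>|M. exp (\<alpha> * h * (\<Sum>i<n. c (Y i \<omega>) (u (Y i \<omega>)))))))"

definition weighted_cont ::
  "real \<Rightarrow> ('e \<Rightarrow> 'a \<Rightarrow> real) \<Rightarrow> ('e \<Rightarrow> 'a) \<Rightarrow> 'w measure \<Rightarrow> (real \<Rightarrow> 'w \<Rightarrow> 'e) \<Rightarrow> 'e set \<Rightarrow> real" where
  "weighted_cont \<alpha> c u M X B =
     (LINT \<omega>|M. exp (\<alpha> * (LBINT s:{0..1}. c (X s \<omega>) (u (X s \<omega>)))) * indicator B (X 1 \<omega>))"

definition weighted_disc ::
  "real \<Rightarrow> ('e \<Rightarrow> 'a \<Rightarrow> real) \<Rightarrow> nat \<Rightarrow> ('e \<Rightarrow> 'a) \<Rightarrow> 'w measure \<Rightarrow> (nat \<Rightarrow> 'w \<Rightarrow> 'e) \<Rightarrow> 'e set \<Rightarrow> real" where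
  "weighted_disc \<alpha> c m u M Y B =
     (LINT \<omega>|M. exp (\<alpha> * (\<Sum>i<2^m. 1 / 2^m * c (Y i \<omega>) (u (Y i \<omega>)))) * indicator B (Y (2^m) \<omega>))"

text \<open>
  Total variation of a finite signed Borel measure, given by its values on Borel sets. The
  supremum is over a bounded set for differences of finite measures, the only case used.
\<close>

definition variation_norm :: "('e::topological_space set \<Rightarrow> real) \<Rightarrow> real" where
  "variation_norm \<sigma> =
     (SUP \<P>\<in>{\<P>. finite \<P> \<and> partition_on UNIV \<P> \<and> \<P> \<subseteq> sets borel}. \<Sum>A\<in>\<P>. \<bar>\<sigma> A\<bar>)"

definition uUE ::
  "('e \<Rightarrow> 'a) set \<Rightarrow> (nat \<Rightarrow> 'a \<Rightarrow> 'e \<Rightarrow> 'e::topological_space measure) \<Rightarrow> bool" where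
  "uUE \<U> Q \<longleftrightarrow> (\<forall>u\<in>\<U>.
     (SUP (m, x, x', B) \<in> UNIV \<times> UNIV \<times> UNIV \<times> sets borel.
        measure (discrete_transition Q m u 1 x) B - measure (discrete_transition Q m u 1 x') B) < 1)"

definition uEquiv ::
  "('e \<Rightarrow> 'a) set \<Rightarrow> (nat \<Rightarrow> 'a \<Rightarrow> 'e \<Rightarrow> 'e::topological_space measure) \<Rightarrow> bool" where
  "uEquiv \<U> Q \<longleftrightarrow> (\<forall>u\<in>\<U>. \<exists>k. \<exists>K::real. \<forall>m x x'. \<forall>B\<in>sets borel.
     measure (discrete_transition Q m u k x) B \<le> K * measure (discrete_transition Q m u k x') B)"

definition eConv ::
  "real \<Rightarrow> ('e \<Rightarrow> 'a \<Rightarrow> real) \<Rightarrow> ('e \<Rightarrow> 'a) set \<Rightarrow>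
   (('e \<Rightarrow> 'a) \<Rightarrow> 'e \<Rightarrow> 'w measure) \<Rightarrow> (('e \<Rightarrow> 'a) \<Rightarrow> real \<Rightarrow> 'w \<Rightarrow> 'e::topological_space) \<Rightarrow>
   (nat \<Rightarrow> ('e \<Rightarrow> 'a) \<Rightarrow> 'e \<Rightarrow> 'v measure) \<Rightarrow> (nat \<Rightarrow> ('e \<Rightarrow> 'a) \<Rightarrow> nat \<Rightarrow> 'v \<Rightarrow> 'e) \<Rightarrow> bool" where
  "eConv \<alpha> c \<U> Pr X PrD Y \<longleftrightarrow> (\<forall>u\<in>\<U>. \<forall>x.
     (\<lambda>m. variation_norm (\<lambda>B.
        weighted_disc \<alpha> c m u (PrD m u x) (Y m u) B - weighted_cont \<alpha> c u (Pr u x) (X u) B))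
     \<longlonglongrightarrow> 0)"

end

theory Submission
  imports Defs
begin

text \<open>
  Fix a control \<open>u\<close> and write \<open>Z\<^sub>t(x)\<close> for the exponential moment of \<open>\<alpha>\<close> times the accumulated
  reward up to time \<open>t\<close>, and \<open>Z\<^sup>m\<^sub>n(x)\<close> for the moment of the chain with step \<open>2\<^sup>-\<^sup>m\<close> after \<open>n\<close> steps. The
  functionals are \<open>1 / \<alpha>\<close> times the growth rates of \<open>ln Z\<close>, and the statement interchanges the limits
  \<open>m \<rightarrow> \<infinity>\<close> and \<open>t \<rightarrow> \<infinity>\<close>. The interchange is possible because the growth rate is approached at a
  speed that does not depend on \<open>m\<close>.

  For the chain, \<open>Z\<^sup>m\<^sub>n\<close> is the \<open>n\<close>-th iterate, applied to the constant 1, of the transition kernel tilted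
  by the exponential of the reward (\<open>nn_integral_chain\<close>). Over the time span \<open>k\<close> of the equivalence
  condition the tilting costs at most a fixed factor, so that condition makes \<open>Z\<^sup>m\<^sub>n\<close> vary with the
  starting point by at most a factor \<open>R\<close> common to all \<open>m\<close> and \<open>n\<close> (\<open>mass_harnack\<close>). Hence
  \<open>ln Z\<^sup>m\<^sub>n\<close> is additive in \<open>n\<close> up to the error \<open>r = ln R\<close> (\<open>ln_mass_almost_additive\<close>), and a sequence
  that is additive up to \<open>r\<close> stays within \<open>r\<close> of a linear one (\<open>almost_additive_linear\<close>). The slope
  of that linear sequence is the growth rate.

  It remains to let \<open>m \<rightarrow> \<infinity>\<close> at a fixed integer time. The variation convergence of the weighted laws
  over one unit of time propagates to every integer time \<open>n\<close> by induction on \<open>n\<close>: the integrands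
  converge pointwise and boundedly while the measures converge in variation
  (\<open>nn_integral_tendsto_variation\<close>). In the limit, \<open>ln Z\<^sub>n\<close> is additive up to the same \<open>r\<close>. Once \<open>m\<close> is
  so large that the logarithms for the chain and for the process at time \<open>n\<close> differ by at most 1, the
  two growth rates differ by at most \<open>(2 r + 1) / n\<close> (\<open>rates_tendsto\<close>).

  The induction uses that \<open>Z\<close> is a semigroup in continuous time: \<open>Z\<^bsub>a+t\<^esub>(x)\<close> is the integral of the
  exponential reward up to time \<open>a\<close> against \<open>Z\<^sub>t(X\<^sub>a)\<close> (\<open>expected_reward_add\<close>). Only the Markov
  property at a single later time is given, while the reward depends on a whole path, and
  the integrated reward up to time \<open>a\<close> need not be measurable for the natural filtration. Both obstacles
  disappear on expanding the exponentials into power series: each term is an iterated time integral of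
  functions of finitely many states, and Fubini's theorem moves the time integrals outside, where the
  one-time Markov property applies (\<open>nn_integral_ordered_integral\<close> for the reward after time \<open>a\<close>,
  \<open>nn_integral_power_accumulated_cong\<close> for the reward before \<open>a\<close>). A constant is added to the
  running reward to make it nonnegative, so that all of this happens with nonnegative integrals.
\<close>

section \<open>The Markov property for nonnegative functions\<close>

lemma subalgebra_natural_filtration:
  assumes "\<And>t. t \<ge> 0 \<Longrightarrow> X t \<in> M \<rightarrow>\<^sub>M borel"
  shows "subalgebra M (natural_filtration M X s)"
  unfolding subalgebra_def natural_filtration_def
  using assms by (auto intro!: sets.sigma_sets_subset measurable_sets simp: sets_measure_of_conv space_measure_of_conv)

lemma measurable_natural_filtration:
  fixes X :: "'t::{linorder, zero} \<Rightarrow> 'w \<Rightarrow> 'e::topological_space"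
  assumes "0 \<le> r" "r \<le> s"
  shows "X r \<in> natural_filtration M X s \<rightarrow>\<^sub>M borel"
proof (rule measurableI)
  fix B :: "'e set" assume "B \<in> sets borel"
  then have "X r -` B \<inter> space M \<in> sigma_sets (space M) {X r -` B \<inter> space M | r B. 0 \<le> r \<and> r \<le> s \<and> B \<in> sets borel}"
    using assms by (intro sigma_sets.Basic) auto
  then show "X r -` B \<inter> space (natural_filtration M X s) \<in> sets (natural_filtration M X s)"
    unfolding natural_filtration_def
    by (subst sets_measure_of) (auto simp: space_measure_of_conv)
qed auto

lemma sets_natural_filtration_mono:
  assumes "s \<le> (t :: 't :: linordered_semidom)"
  shows "sets (natural_filtration M X s) \<subseteq> sets (natural_filtration M X t)"
  unfolding natural_filtration_def using assms
  by (auto simp: sets_measure_of_conv intro!: sigma_sets_mono') (blast intro: order_trans)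

lemma borel_measurable_natural_filtration_mono:
  assumes "s \<le> (t :: 't :: linordered_semidom)" "G \<in> borel_measurable (natural_filtration M X s)"
  shows "G \<in> borel_measurable (natural_filtration M X t)"
proof -
  have "subalgebra (natural_filtration M X t) (natural_filtration M X s)"
    using sets_natural_filtration_mono[OF assms(1)]
    by (auto simp: subalgebra_def natural_filtration_def space_measure_of_conv)
  from measurable_from_subalg[OF this assms(2)] show ?thesis .
qed

text \<open>
  The conditional expectation of an indicator is given by the transition operator; integrating it
  against a nonnegative function of the past and approximating \<open>f\<close> monotonically by simple functions
  gives the Markov property in the integrated form that all later arguments use.
\<close>

lemma markov_process_nn_integral:
  fixes P :: "'t::linordered_semidom \<Rightarrow> 'e \<Rightarrow> 'e::topological_space measure"
  assumes markov: "markov_process P x M X" and s: "0 \<le> s" and t: "0 \<le> t"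
    and P: "P t \<in> borel \<rightarrow>\<^sub>M prob_algebra borel"
    and G: "G \<in> borel_measurable (natural_filtration M X s)" and f: "f \<in> borel_measurable borel"
  shows "(\<integral>\<^sup>+\<omega>. G \<omega> * f (X (s + t) \<omega>) \<partial>M) = (\<integral>\<^sup>+\<omega>. G \<omega> * (\<integral>\<^sup>+y. f y \<partial>P t (X s \<omega>)) \<partial>M)"
proof -
  let ?F = "natural_filtration M X s"
  interpret M: prob_space M using markov by (simp add: markov_process_def)
  have X[measurable]: "X r \<in> M \<rightarrow>\<^sub>M borel" if "0 \<le> r" for r
    using markov that by (simp add: markov_process_def)
  have Xs[measurable]: "X s \<in> M \<rightarrow>\<^sub>M borel" "X (s + t) \<in> M \<rightarrow>\<^sub>M borel" using s t by auto
  have P'[measurable]: "P t \<in> borel \<rightarrow>\<^sub>M subprob_algebra borel"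
    using P by (rule measurable_prob_algebraD)
  have probP: "prob_space (P t y)" and setsP: "sets (P t y) = sets borel" for y
    using measurable_space[OF P, of y] by (auto simp: space_prob_algebra)
  have sub: "subalgebra M ?F" using X by (rule subalgebra_natural_filtration)
  interpret F: finite_measure_subalgebra M ?F by unfold_locales (rule sub)
  have GM[measurable]: "G \<in> borel_measurable M" using measurable_from_subalg[OF sub G] .
  show ?thesis using f
  proof (induction rule: borel_measurable_induct)
    case (cong f g)
    then show ?case by (simp cong: nn_integral_cong)
  next
    case (set B)
    let ?i = "\<lambda>\<omega>. indicator B (X (s + t) \<omega>) :: real"
    let ?N = "nn_cond_exp M ?F (\<lambda>\<omega>. ennreal (?i \<omega>))"
    let ?Neg = "nn_cond_exp M ?F (\<lambda>\<omega>. ennreal (- ?i \<omega>))"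
    have Bm[measurable]: "B \<in> sets borel" by fact
    have i0: "(\<lambda>\<omega>. ennreal (- ?i \<omega>)) = (\<lambda>_. 0)" by (auto simp: ennreal_neg)
    have "AE \<omega> in M. 0 = ?Neg \<omega>"
      unfolding i0 by (intro F.nn_cond_exp_F_meas) auto
    moreover have "AE \<omega> in M. ?N \<omega> \<le> nn_cond_exp M ?F (\<lambda>_. 1) \<omega>"
      by (intro F.nn_cond_exp_mono) (auto simp: indicator_def)
    moreover have "AE \<omega> in M. 1 = nn_cond_exp M ?F (\<lambda>_. 1) \<omega>"
      by (intro F.nn_cond_exp_F_meas) auto
    moreover have "AE \<omega> in M. real_cond_exp M ?F ?i \<omega> = measure (P t (X s \<omega>)) B"
      using markov s t Bm by (simp add: markov_process_def)
    \<comment> \<open>The real conditional expectation discards infinite values, so finiteness has to be known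
      before the nonnegative one can be identified.\<close>
    ultimately have ae: "AE \<omega> in M. ?N \<omega> = emeasure (P t (X s \<omega>)) B"
    proof eventually_elim
      case (elim \<omega>)
      interpret p: prob_space "P t (X s \<omega>)" by (rule probP)
      have "enn2real (?N \<omega>) - enn2real (?Neg \<omega>) = measure (P t (X s \<omega>)) B"
        using elim(4) by (simp only: real_cond_exp_def)
      then have "enn2real (?N \<omega>) = measure (P t (X s \<omega>)) B"
        using elim(1) by (metis enn2real_0 diff_zero)
      moreover have "?N \<omega> < \<top>" using elim by (metis ennreal_one_less_top order_le_less_trans)
      ultimately show ?case
        by (metis ennreal_enn2real p.emeasure_eq_measure)
    qed
    have "(\<integral>\<^sup>+\<omega>. G \<omega> * indicator B (X (s + t) \<omega>) \<partial>M) = (\<integral>\<^sup>+\<omega>. G \<omega> * ennreal (?i \<omega>) \<partial>M)"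
      by (simp add: ennreal_indicator)
    also have "\<dots> = (\<integral>\<^sup>+\<omega>. G \<omega> * ?N \<omega> \<partial>M)"
      using G by (intro F.nn_cond_exp_intg[symmetric]) auto
    also have "\<dots> = (\<integral>\<^sup>+\<omega>. G \<omega> * emeasure (P t (X s \<omega>)) B \<partial>M)"
      by (intro nn_integral_cong_AE) (use ae in eventually_elim, simp)
    finally show ?case by (simp add: setsP nn_integral_indicator)
  next
    case (mult f c)
    have "(\<integral>\<^sup>+\<omega>. G \<omega> * (c * f (X (s + t) \<omega>)) \<partial>M) = c * (\<integral>\<^sup>+\<omega>. G \<omega> * f (X (s + t) \<omega>) \<partial>M)"
      using mult(2) by (subst nn_integral_cmult[symmetric]) (auto simp: ac_simps)
    also have "\<dots> = (\<integral>\<^sup>+\<omega>. G \<omega> * (c * (\<integral>\<^sup>+y. f y \<partial>P t (X s \<omega>))) \<partial>M)"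
      using mult(2) unfolding mult.IH by (subst nn_integral_cmult[symmetric]) (auto simp: ac_simps)
    finally show ?case using mult(2) by (simp add: nn_integral_cmult setsP cong: measurable_cong_sets)
  next
    case (add f g)
    note [measurable] = add(1,3)
    have "(\<integral>\<^sup>+\<omega>. G \<omega> * (f (X (s + t) \<omega>) + g (X (s + t) \<omega>)) \<partial>M) =
        (\<integral>\<^sup>+\<omega>. G \<omega> * f (X (s + t) \<omega>) \<partial>M) + (\<integral>\<^sup>+\<omega>. G \<omega> * g (X (s + t) \<omega>) \<partial>M)"
      by (subst nn_integral_add[symmetric]) (auto simp: distrib_left)
    also have "\<dots> = (\<integral>\<^sup>+\<omega>. G \<omega> * ((\<integral>\<^sup>+y. f y \<partial>P t (X s \<omega>)) + (\<integral>\<^sup>+y. g y \<partial>P t (X s \<omega>))) \<partial>M)"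
      unfolding add.IH by (subst nn_integral_add[symmetric]) (auto simp: distrib_left)
    finally show ?case by (simp add: nn_integral_add setsP add.commute cong: measurable_cong_sets)
  next
    case (seq U)
    note [measurable] = seq(1)
    have inc: "incseq (\<lambda>i. U i y)" for y using seq by (auto simp: incseq_def le_fun_def)
    have "(\<integral>\<^sup>+\<omega>. G \<omega> * (SUP i. U i (X (s + t) \<omega>)) \<partial>M) = (SUP i. \<integral>\<^sup>+\<omega>. G \<omega> * U i (X (s + t) \<omega>) \<partial>M)"
      by (subst SUP_mult_left_ennreal, subst nn_integral_monotone_convergence_SUP[symmetric])
         (use inc in \<open>auto simp: incseq_def le_fun_def intro!: mult_left_mono\<close>)
    also have "\<dots> = (SUP i. \<integral>\<^sup>+\<omega>. G \<omega> * (\<integral>\<^sup>+y. U i y \<partial>P t (X s \<omega>)) \<partial>M)"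
      using seq by simp
    also have "\<dots> = (\<integral>\<^sup>+\<omega>. G \<omega> * (SUP i. \<integral>\<^sup>+y. U i y \<partial>P t (X s \<omega>)) \<partial>M)"
      by (subst SUP_mult_left_ennreal, subst nn_integral_monotone_convergence_SUP[symmetric])
         (use inc in \<open>auto simp: incseq_def le_fun_def intro!: mult_left_mono nn_integral_mono\<close>)
    also have "\<dots> = (\<integral>\<^sup>+\<omega>. G \<omega> * (\<integral>\<^sup>+y. (SUP i. U i y) \<partial>P t (X s \<omega>)) \<partial>M)"
      by (subst nn_integral_monotone_convergence_SUP)
         (use inc in \<open>auto simp: incseq_def le_fun_def setsP cong: measurable_cong_sets\<close>)
    finally show ?case by (simp add: image_comp)
  qed
qed

section \<open>Integrals over ordered times\<close>

text \<open>
  The integral of \<open>v(s\<^sub>1) \<dots> v(s\<^sub>n)\<close> over \<open>a \<le> s\<^sub>1 \<le> \<dots> \<le> s\<^sub>n \<le> t\<close>, with the earliest time outermost: the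
  Markov property can then be applied at \<open>s\<^sub>1\<close> first, with everything later treated by induction.
\<close>

primrec ordered_integral :: "(real \<Rightarrow> ennreal) \<Rightarrow> real \<Rightarrow> nat \<Rightarrow> real \<Rightarrow> ennreal" where
  "ordered_integral v t 0 a = 1"
| "ordered_integral v t (Suc n) a = (\<integral>\<^sup>+s. indicator {a..t} s * (v s * ordered_integral v t n s) \<partial>lborel)"

lemma measurable_ordered_integral:
  assumes [measurable]: "(\<lambda>(s, \<omega>). v s \<omega>) \<in> borel_measurable (borel \<Otimes>\<^sub>M M)"
  shows "(\<lambda>(a, \<omega>). ordered_integral (\<lambda>s. v s \<omega>) t n a) \<in> borel_measurable (borel \<Otimes>\<^sub>M M)"
proof (induction n)
  case (Suc n)
  note [measurable] = Suc.IH
  have [measurable]: "(\<lambda>z. indicator {fst (fst z)..t} (snd z) :: ennreal) \<in> borel_measurable ((borel \<Otimes>\<^sub>M M) \<Otimes>\<^sub>M lborel)"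
    by (auto simp: indicator_def cong: if_cong)
  show ?case by (simp add: split_beta')
qed simp

lemma measurable_ordered_integral':
  assumes [measurable]: "v \<in> borel_measurable borel"
  shows "ordered_integral v t n \<in> borel_measurable borel"
proof -
  have "(\<lambda>(a, \<omega>::unit). ordered_integral (\<lambda>s. v s) t n a) \<in> borel_measurable (borel \<Otimes>\<^sub>M count_space UNIV)"
    by (rule measurable_ordered_integral) simp
  then have "(\<lambda>a. (\<lambda>(a, \<omega>::unit). ordered_integral (\<lambda>s. v s) t n a) (a, ())) \<in> borel_measurable borel"
    by (rule measurable_compose_rev) simp
  then show ?thesis by simp
qed

text \<open>
  Multiplying an ordered \<open>n\<close>-fold integral by one more unordered time inserts that time into any of the
  \<open>n + 1\<close> positions. In the proof the extra time either precedes the first ordered one, which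
  gives one ordered integral by Fubini's theorem, or follows it, which is the induction hypothesis.
\<close>

lemma ordered_integral_Suc:
  assumes v[measurable]: "v \<in> borel_measurable borel"
  shows "of_nat (Suc n) * ordered_integral v t (Suc n) a = 
    (\<integral>\<^sup>+s. indicator {a..t} s * v s \<partial>lborel) * ordered_integral v t n a"
proof (induction n arbitrary: a)
  case (Suc k)
  note [measurable] = measurable_ordered_integral'[OF v]
  let ?F = "\<lambda>a. \<integral>\<^sup>+s. indicator {a..t} s * v s \<partial>lborel"
  let ?J = "ordered_integral v t"
  have [measurable]: "(\<lambda>z. indicator {a..<fst z} (snd z) :: ennreal) \<in> borel_measurable (lborel \<Otimes>\<^sub>M lborel)"
    "(\<lambda>z. indicator {a..<snd z} (fst z) :: ennreal) \<in> borel_measurable (lborel \<Otimes>\<^sub>M lborel)" for a :: real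
    by (auto simp: indicator_def cong: if_cong)
  have [measurable]: "(\<lambda>z. indicator {fst z..t} (snd z) :: ennreal) \<in> borel_measurable (lborel \<Otimes>\<^sub>M lborel)" for t :: real
    by (auto simp: indicator_def cong: if_cong)
  have Fm[measurable]: "?F \<in> borel_measurable borel"
    by (intro sigma_finite_measure.borel_measurable_nn_integral[OF sigma_finite_lborel])
       (auto simp: split_beta' indicator_def cong: if_cong)
  have split: "indicator {a..t} r * ?F a = 
      indicator {a..t} r * (\<integral>\<^sup>+s. indicator {a..<r} s * v s \<partial>lborel) + indicator {a..t} r * ?F r" for r
  proof (cases "r \<in> {a..t}")
    case True
    have "?F a = (\<integral>\<^sup>+s. indicator {a..<r} s * v s + indicator {r..t} s * v s \<partial>lborel)"
      using True by (intro nn_integral_cong) (auto simp: indicator_def)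
    also have "\<dots> = (\<integral>\<^sup>+s. indicator {a..<r} s * v s \<partial>lborel) + ?F r"
      by (intro nn_integral_add) auto
    finally show ?thesis by (simp add: distrib_left)
  qed simp
  have "?F a * ?J (Suc k) a = (\<integral>\<^sup>+r. (indicator {a..t} r * ?F a) * (v r * ?J k r) \<partial>lborel)"
    by (simp add: nn_integral_cmult[symmetric] ac_simps)
  also have "\<dots> = (\<integral>\<^sup>+r. (\<integral>\<^sup>+s. indicator {a..<r} s * v s * (indicator {a..t} r * (v r * ?J k r)) \<partial>lborel)
      + indicator {a..t} r * (v r * (?F r * ?J k r)) \<partial>lborel)"
    unfolding split by (subst nn_integral_multc) (auto simp: distrib_left distrib_right ac_simps)
  also have "\<dots> = (\<integral>\<^sup>+r. \<integral>\<^sup>+s. indicator {a..<r} s * v s * (indicator {a..t} r * (v r * ?J k r)) \<partial>lborel \<partial>lborel)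
      + (\<integral>\<^sup>+r. indicator {a..t} r * (v r * (?F r * ?J k r)) \<partial>lborel)"
    by (intro nn_integral_add) (auto simp: split_beta')
  also have "(\<integral>\<^sup>+r. indicator {a..t} r * (v r * (?F r * ?J k r)) \<partial>lborel) = of_nat (Suc k) * ?J (Suc (Suc k)) a"
    unfolding Suc.IH[symmetric] 
    by (simp only: ordered_integral.simps(2)[of v t "Suc k"], subst nn_integral_cmult[symmetric])
       (auto simp: ac_simps simp del: ordered_integral.simps)
  also have "(\<integral>\<^sup>+r. \<integral>\<^sup>+s. indicator {a..<r} s * v s * (indicator {a..t} r * (v r * ?J k r)) \<partial>lborel \<partial>lborel) =
      (\<integral>\<^sup>+s. \<integral>\<^sup>+r. indicator {a..<r} s * v s * (indicator {a..t} r * (v r * ?J k r)) \<partial>lborel \<partial>lborel)"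
    by (rule lborel_pair.Fubini') (simp add: split_beta')
  also have "\<dots> = (\<integral>\<^sup>+s. indicator {a..t} s * (v s * (\<integral>\<^sup>+r. indicator {s..t} r * (v r * ?J k r) \<partial>lborel)) \<partial>lborel)"
  proof (intro nn_integral_cong)
    fix s :: real
    \<comment> \<open>The two sides treat \<open>r = s\<close> differently, which affects a null set only.\<close>
    have "(\<integral>\<^sup>+r. indicator {a..<r} s * v s * (indicator {a..t} r * (v r * ?J k r)) \<partial>lborel) =
      (\<integral>\<^sup>+r. indicator {a..t} s * v s * (indicator {s..t} r * (v r * ?J k r)) \<partial>lborel)"
      by (rule nn_integral_cong_AE) (use AE_lborel_singleton[of s] in eventually_elim, auto simp: indicator_def)
    also have "\<dots> = indicator {a..t} s * (v s * (\<integral>\<^sup>+r. indicator {s..t} r * (v r * ?J k r) \<partial>lborel))"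
      by (subst nn_integral_cmult) (auto simp: ac_simps)
    finally show "(\<integral>\<^sup>+r. indicator {a..<r} s * v s * (indicator {a..t} r * (v r * ?J k r)) \<partial>lborel) =
      indicator {a..t} s * (v s * (\<integral>\<^sup>+r. indicator {s..t} r * (v r * ?J k r) \<partial>lborel))" .
  qed
  finally show ?case by (simp add: distrib_right)
qed simp

lemma ordered_integral_eq_power:
  assumes "v \<in> borel_measurable borel"
  shows "fact n * ordered_integral v t n a = (\<integral>\<^sup>+s. indicator {a..t} s * v s \<partial>lborel) ^ n"
proof (induction n)
  case (Suc n)
  have "fact (Suc n) * ordered_integral v t (Suc n) a = fact n * (of_nat (Suc n) * ordered_integral v t (Suc n) a)"
    by (simp add: ac_simps del: ordered_integral.simps)
  also have "\<dots> = (\<integral>\<^sup>+s. indicator {a..t} s * v s \<partial>lborel) * (fact n * ordered_integral v t n a)"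
    unfolding ordered_integral_Suc[OF assms] by (simp add: ac_simps)
  finally show ?case by (simp add: Suc.IH)
qed simp

text \<open>
  The exponential is needed on nonnegative extended reals in its power series form, so that it can be
  integrated term by term.
\<close>

definition ennreal_exp :: "ennreal \<Rightarrow> ennreal" where
  "ennreal_exp z = (\<Sum>n. z ^ n / fact n)"

lemma ennreal_exp_ennreal:
  assumes "0 \<le> r" shows "ennreal_exp (ennreal r) = ennreal (exp r)"
proof -
  have f: "(fact n :: ennreal) = ennreal (fact n)" for n
    by (metis ennreal_of_nat_eq_real_of_nat of_nat_fact)
  have "ennreal r ^ n / fact n = ennreal (r ^ n / fact n)" for n
    unfolding f using assms by (simp add: ennreal_power divide_ennreal)
  moreover have "(\<lambda>n. r ^ n / fact n) sums exp r"
    using exp_converges[of r] by (simp add: divide_inverse mult.commute scaleR_conv_of_real)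
  ultimately show ?thesis
    unfolding ennreal_exp_def using assms
    by (simp add: suminf_ennreal_eq sums_iff)
qed

lemma measurable_ennreal_exp[measurable]: "ennreal_exp \<in> borel_measurable borel"
  unfolding ennreal_exp_def by measurable

lemma suminf_ordered_integral:
  assumes "v \<in> borel_measurable borel"
  shows "(\<Sum>n. ordered_integral v t n a) = ennreal_exp (\<integral>\<^sup>+s. indicator {a..t} s * v s \<partial>lborel)"
proof -
  have "(fact n :: ennreal) \<noteq> 0" "(fact n :: ennreal) \<noteq> \<top>" for n
    by (metis fact_nonzero of_nat_eq_0_iff of_nat_fact) (metis of_nat_fact ennreal_of_nat_neq_top)
  then have "ordered_integral v t n a = (\<integral>\<^sup>+s. indicator {a..t} s * v s \<partial>lborel) ^ n / fact n" for n
    by (metis ordered_integral_eq_power[OF assms] mult.commute ennreal_mult_divide_eq)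
  then show ?thesis by (simp add: ennreal_exp_def)
qed

section \<open>The Dyson series of a Markov process with a potential\<close>

text \<open>
  These are the terms of the Dyson series of the Feynman-Kac semigroup with potential \<open>V\<close>, applied to
  the constant 1. They are built from the transition operators alone and are jointly measurable in time and state,
  which an expectation over a different path space for each starting point does not show.
\<close>

primrec dyson :: "(real \<Rightarrow> 'e \<Rightarrow> 'e measure) \<Rightarrow> ('e \<Rightarrow> ennreal) \<Rightarrow> nat \<Rightarrow> real \<Rightarrow> 'e \<Rightarrow> ennreal" where
  "dyson P V 0 r x = 1"
| "dyson P V (Suc n) r x =
     (\<integral>\<^sup>+s. indicator {0..r} s * (\<integral>\<^sup>+y. V y * dyson P V n (r - s) y \<partial>P s x) \<partial>lborel)"

definition dyson_sum :: "(real \<Rightarrow> 'e \<Rightarrow> 'e measure) \<Rightarrow> ('e \<Rightarrow> ennreal) \<Rightarrow> real \<Rightarrow> 'e \<Rightarrow> ennreal" where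
  "dyson_sum P V r x = (\<Sum>n. dyson P V n r x)"

lemma measurable_transition_max:
  fixes P :: "real \<Rightarrow> 'e::topological_space \<Rightarrow> 'e measure"
  assumes "(\<lambda>(t, x). P t x) \<in> restrict_space borel {0..} \<Otimes>\<^sub>M borel \<rightarrow>\<^sub>M prob_algebra borel"
  shows "(\<lambda>(t, x). P (max 0 t) x) \<in> borel \<Otimes>\<^sub>M borel \<rightarrow>\<^sub>M subprob_algebra borel"

proof -
  have "(\<lambda>z. (max 0 (fst z), snd z)) \<in> borel \<Otimes>\<^sub>M borel \<rightarrow>\<^sub>M
      restrict_space borel {0::real..} \<Otimes>\<^sub>M (borel :: 'e measure)"
    by (intro measurable_Pair measurable_restrict_space2) auto
  from measurable_compose[OF this measurable_prob_algebraD[OF assms]] show ?thesis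
    by (simp add: split_beta')
qed

lemma measurable_dyson:
  assumes P: "(\<lambda>(t, x). P t x) \<in> restrict_space borel {0..} \<Otimes>\<^sub>M borel \<rightarrow>\<^sub>M prob_algebra borel"
    and V[measurable]: "V \<in> borel_measurable borel"
  shows "(\<lambda>(r, x). dyson P V n r x) \<in> borel_measurable (borel \<Otimes>\<^sub>M borel)"
proof (induction n)
  case (Suc n)
  note [measurable] = Suc.IH
  have L: "(\<lambda>z. P (max 0 (snd z)) (snd (fst z))) \<in> (borel \<Otimes>\<^sub>M borel) \<Otimes>\<^sub>M lborel \<rightarrow>\<^sub>M subprob_algebra borel"
    using measurable_compose[OF _ measurable_transition_max[OF P], of "\<lambda>z. (snd z, snd (fst z))" "(borel \<Otimes>\<^sub>M borel) \<Otimes>\<^sub>M lborel"]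
    by (simp add: split_beta')
  have [measurable]: "(\<lambda>z. \<integral>\<^sup>+y. V y * dyson P V n (fst (fst z) - snd z) y \<partial>P (max 0 (snd z)) (snd (fst z)))
      \<in> borel_measurable ((borel \<Otimes>\<^sub>M borel) \<Otimes>\<^sub>M lborel)"
    by (rule nn_integral_measurable_subprob_algebra2[OF _ L]) (simp add: split_beta')
  have [measurable]: "(\<lambda>z. indicator {0..fst (fst z) :: real} (snd z) :: ennreal) \<in> borel_measurable ((borel \<Otimes>\<^sub>M (borel :: 'a measure)) \<Otimes>\<^sub>M lborel)"
    by (auto simp: indicator_def cong: if_cong)
  have eq: "dyson P V (Suc n) r x = 
     (\<integral>\<^sup>+s. indicator {0..r} s * (\<integral>\<^sup>+y. V y * dyson P V n (r - s) y \<partial>P (max 0 s) x) \<partial>lborel)" for r x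
    by (auto intro!: nn_integral_cong simp: indicator_def max_def)
  show ?case unfolding eq by (simp add: split_beta')
qed simp

lemma measurable_dyson_sum:
  assumes P: "(\<lambda>(t, x). P t x) \<in> restrict_space borel {0..} \<Otimes>\<^sub>M borel \<rightarrow>\<^sub>M prob_algebra borel"
    and V[measurable]: "V \<in> borel_measurable borel"
  shows "dyson_sum P V r \<in> borel_measurable borel"
proof -
  note [measurable] = measurable_dyson[OF assms]
  have "dyson P V n r \<in> borel_measurable borel" for n
    using measurable_compose[OF _ measurable_dyson[OF assms], of "\<lambda>x. (r, x)" borel n] by simp
  then show ?thesis unfolding dyson_sum_def by measurable
qed

text \<open>
  The law \<open>M\<close> belongs to one starting point \<open>x\<close>, whereas the Dyson series depends on \<open>P\<close> and \<open>V\<close> only;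
  results for different starting points are compared through the series.
\<close>

locale additive_functional =
  fixes P :: "real \<Rightarrow> 'e \<Rightarrow> 'e::topological_space measure" and x :: 'e
    and M :: "'w measure" and X :: "real \<Rightarrow> 'w \<Rightarrow> 'e" and V :: "'e \<Rightarrow> ennreal"
  assumes transition: "(\<lambda>(t, x). P t x) \<in> restrict_space borel {0..} \<Otimes>\<^sub>M borel \<rightarrow>\<^sub>M prob_algebra borel"
    and markov: "markov_process P x M X"
    and paths: "(\<lambda>(t, \<omega>). X t \<omega>) \<in> restrict_space borel {0..} \<Otimes>\<^sub>M M \<rightarrow>\<^sub>M borel"
    and V[measurable]: "V \<in> borel_measurable borel"
begin

sublocale prob_space M using markov by (simp add: markov_process_def)

sublocale pair_sigma_finite M lborel ..

text \<open>
  Paths are measurable for nonnegative times only; freezing the process before time 0 gives a function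
  that is jointly measurable on the whole line.
\<close>

definition "rate s \<omega> = V (X (max 0 s) \<omega>)"

lemma measurable_rate[measurable]: "(\<lambda>(s, \<omega>). rate s \<omega>) \<in> borel_measurable (borel \<Otimes>\<^sub>M M)"
proof -
  have "(\<lambda>z. (max 0 (fst z), snd z)) \<in> borel \<Otimes>\<^sub>M M \<rightarrow>\<^sub>M restrict_space borel {0::real..} \<Otimes>\<^sub>M M"
    by (intro measurable_Pair measurable_restrict_space2) auto
  from measurable_compose[OF this measurable_compose[OF paths V]] show ?thesis
    by (simp add: split_beta' rate_def)
qed

lemma measurable_state[measurable]: "0 \<le> r \<Longrightarrow> X r \<in> M \<rightarrow>\<^sub>M borel"
  using markov by (simp add: markov_process_def)

lemma measurable_natural:
  assumes "G \<in> borel_measurable (natural_filtration M X s)"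
  shows "G \<in> borel_measurable M"
  by (rule measurable_from_subalg[OF subalgebra_natural_filtration assms]) auto

definition "accumulated a t \<omega> = (\<integral>\<^sup>+s. indicator {a..t} s * rate s \<omega> \<partial>lborel)"

lemma measurable_accumulated[measurable]: "accumulated a t \<in> borel_measurable M"
proof -
  have "(\<lambda>\<omega>. \<integral>\<^sup>+s. indicator {a..t} s * rate s \<omega> \<partial>lborel) \<in> borel_measurable M"
    by measurable
  then show ?thesis unfolding accumulated_def .
qed

lemma measurable_rate_time: "\<omega> \<in> space M \<Longrightarrow> (\<lambda>s. rate s \<omega>) \<in> borel_measurable borel"
  using measurable_rate by measurable

lemma measurable_rate_state: "(\<lambda>\<omega>. rate s \<omega>) \<in> borel_measurable M"
  using measurable_rate by measurable

text \<open>
  The earliest time \<open>s\<close> is split off. The factor \<open>V(X\<^sub>s)\<close> is known at time \<open>s\<close>, so it joins \<open>G\<close> and the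
  induction hypothesis applies from \<open>s\<close> on; the resulting function of \<open>X\<^sub>s\<close> is brought back to time
  \<open>a\<close> by the Markov property.
\<close>

lemma nn_integral_ordered_integral:
  assumes "0 \<le> a" "a \<le> t" "G \<in> borel_measurable (natural_filtration M X a)"
  shows "(\<integral>\<^sup>+\<omega>. G \<omega> * ordered_integral (\<lambda>s. rate s \<omega>) t n a \<partial>M) =
    (\<integral>\<^sup>+\<omega>. G \<omega> * dyson P V n (t - a) (X a \<omega>) \<partial>M)"
  using assms
proof (induction n arbitrary: a G)
  case (Suc n)
  note [measurable] = measurable_natural[OF Suc.prems(3)] measurable_ordered_integral[OF measurable_rate]
    measurable_dyson[OF transition V] measurable_rate_state
  have [measurable]: "X a \<in> M \<rightarrow>\<^sub>M borel" using Suc.prems by simp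
  let ?J = "\<lambda>\<omega>. ordered_integral (\<lambda>s. rate s \<omega>) t"
  let ?k = "\<lambda>s z. \<integral>\<^sup>+y. V y * dyson P V n (t - s) y \<partial>P (max 0 (s - a)) z"
  have Jm[measurable]: "(\<lambda>\<omega>. ?J \<omega> n s) \<in> borel_measurable M" for s
    using measurable_compose[OF _ measurable_ordered_integral[OF measurable_rate, of t n], of "\<lambda>\<omega>. (s, \<omega>)" M] by simp
  have dm[measurable]: "dyson P V n r \<in> borel_measurable borel" for r
    using measurable_compose[OF _ measurable_dyson[OF transition V], of "\<lambda>x. (r, x)" borel n] by simp
  have L: "(\<lambda>z. P (max 0 (snd z - a)) (X a (fst z))) \<in> M \<Otimes>\<^sub>M lborel \<rightarrow>\<^sub>M subprob_algebra borel"
    using measurable_compose[OF _ measurable_transition_max[OF transition], of "\<lambda>z. (snd z - a, X a (fst z))"]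
    by (simp add: split_beta')
  have km[measurable]: "(\<lambda>z. ?k (snd z) (X a (fst z))) \<in> borel_measurable (M \<Otimes>\<^sub>M lborel)"
    by (rule nn_integral_measurable_subprob_algebra2[OF _ L]) (simp add: split_beta')
  have "(\<integral>\<^sup>+\<omega>. G \<omega> * ?J \<omega> (Suc n) a \<partial>M) =
      (\<integral>\<^sup>+\<omega>. \<integral>\<^sup>+s. indicator {a..t} s * ((G \<omega> * rate s \<omega>) * ?J \<omega> n s) \<partial>lborel \<partial>M)"
    using measurable_rate_time measurable_ordered_integral'[OF measurable_rate_time]
    by (auto simp: nn_integral_cmult[symmetric] ac_simps intro!: nn_integral_cong)
  also have "\<dots> = (\<integral>\<^sup>+s. \<integral>\<^sup>+\<omega>. indicator {a..t} s * ((G \<omega> * rate s \<omega>) * ?J \<omega> n s) \<partial>M \<partial>lborel)"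
    by (rule Fubini'[symmetric]) (simp add: split_beta')
  also have "\<dots> = (\<integral>\<^sup>+s. \<integral>\<^sup>+\<omega>. indicator {a..t} s * (G \<omega> * ?k s (X a \<omega>)) \<partial>M \<partial>lborel)"
  proof (rule nn_integral_cong)
    fix s :: real
    show "(\<integral>\<^sup>+\<omega>. indicator {a..t} s * ((G \<omega> * rate s \<omega>) * ?J \<omega> n s) \<partial>M) =
        (\<integral>\<^sup>+\<omega>. indicator {a..t} s * (G \<omega> * ?k s (X a \<omega>)) \<partial>M)"
    proof (cases "s \<in> {a..t}")
      case True
      then have s: "a \<le> s" "s \<le> t" "0 \<le> s" "0 \<le> s - a" "max 0 s = s" "max 0 (s - a) = s - a" "a + (s - a) = s"
        using Suc.prems by auto
      have Xs: "X s \<in> natural_filtration M X s \<rightarrow>\<^sub>M borel"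
        using s by (intro measurable_natural_filtration) auto
      have Gs: "G \<in> borel_measurable (natural_filtration M X s)"
        using borel_measurable_natural_filtration_mono[OF s(1) Suc.prems(3)] .
      have "(\<lambda>\<omega>. G \<omega> * rate s \<omega>) \<in> borel_measurable (natural_filtration M X s)"
        unfolding rate_def s using Gs measurable_compose[OF Xs V] by simp
      from Suc.IH[OF s(3,2) this]
      have "(\<integral>\<^sup>+\<omega>. (G \<omega> * rate s \<omega>) * ?J \<omega> n s \<partial>M) = (\<integral>\<^sup>+\<omega>. (G \<omega> * rate s \<omega>) * dyson P V n (t - s) (X s \<omega>) \<partial>M)" .
      also have "\<dots> = (\<integral>\<^sup>+\<omega>. G \<omega> * (V (X (a + (s - a)) \<omega>) * dyson P V n (t - s) (X (a + (s - a)) \<omega>)) \<partial>M)"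
        unfolding rate_def s by (simp add: mult.assoc)
      also have "\<dots> = (\<integral>\<^sup>+\<omega>. G \<omega> * (\<integral>\<^sup>+y. V y * dyson P V n (t - s) y \<partial>P (s - a) (X a \<omega>)) \<partial>M)"
      proof (rule markov_process_nn_integral[OF markov Suc.prems(1) s(4) _ Suc.prems(3)])
        show "P (s - a) \<in> borel \<rightarrow>\<^sub>M prob_algebra borel"
          using measurable_compose[OF _ transition, of "\<lambda>x. (s - a, x)" borel] s
          by (simp add: space_restrict_space)
      qed measurable
      finally show ?thesis using True s by simp
    qed simp
  qed
  also have "\<dots> = (\<integral>\<^sup>+\<omega>. \<integral>\<^sup>+s. indicator {a..t} s * (G \<omega> * ?k s (X a \<omega>)) \<partial>lborel \<partial>M)"
    by (rule Fubini') (simp add: split_beta')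
  also have "\<dots> = (\<integral>\<^sup>+\<omega>. G \<omega> * dyson P V (Suc n) (t - a) (X a \<omega>) \<partial>M)"
  proof (rule nn_integral_cong)
    fix \<omega> assume \<omega>: "\<omega> \<in> space M"
    have [measurable]: "(\<lambda>s. ?k s (X a \<omega>)) \<in> borel_measurable borel"
      using measurable_compose[OF _ km, of "\<lambda>s. (\<omega>, s)" borel] \<omega> by simp
    have "(\<integral>\<^sup>+s. indicator {a..t} s * (G \<omega> * ?k s (X a \<omega>)) \<partial>lborel) = 
      G \<omega> * (\<integral>\<^sup>+s. indicator {a..t} s * ?k s (X a \<omega>) \<partial>lborel)"
      by (subst nn_integral_cmult[symmetric]) (auto simp: ac_simps)
    also have "(\<integral>\<^sup>+s. indicator {a..t} s * ?k s (X a \<omega>) \<partial>lborel) = 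
       (\<integral>\<^sup>+s. indicator {a..t} (a + 1 * s) * ?k (a + 1 * s) (X a \<omega>) \<partial>lborel)"
      by (subst nn_integral_real_affine[where c=1 and t=a]) auto
    also have "\<dots> = dyson P V (Suc n) (t - a) (X a \<omega>)"
      by (auto intro!: nn_integral_cong simp: indicator_def algebra_simps)
    finally show "(\<integral>\<^sup>+s. indicator {a..t} s * (G \<omega> * ?k s (X a \<omega>)) \<partial>lborel) = 
      G \<omega> * dyson P V (Suc n) (t - a) (X a \<omega>)" .
  qed
  finally show ?case .
qed simp

lemma nn_integral_exp_accumulated:
  assumes a: "0 \<le> a" "a \<le> t" and G: "G \<in> borel_measurable (natural_filtration M X a)"
  shows "(\<integral>\<^sup>+\<omega>. G \<omega> * ennreal_exp (accumulated a t \<omega>) \<partial>M) = (\<integral>\<^sup>+\<omega>. G \<omega> * dyson_sum P V (t - a) (X a \<omega>) \<partial>M)"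
proof -
  note [measurable] = measurable_natural[OF G]
  have [measurable]: "X a \<in> M \<rightarrow>\<^sub>M borel" using a by simp
  have [measurable]: "(\<lambda>\<omega>. ordered_integral (\<lambda>s. rate s \<omega>) t n a) \<in> borel_measurable M" for n
    using measurable_compose[OF _ measurable_ordered_integral[OF measurable_rate, of t n], of "\<lambda>\<omega>. (a, \<omega>)" M] by simp
  have [measurable]: "dyson P V n r \<in> borel_measurable borel" for r n
    using measurable_compose[OF _ measurable_dyson[OF transition V], of "\<lambda>x. (r, x)" borel n] by simp
  have "(\<integral>\<^sup>+\<omega>. G \<omega> * ennreal_exp (accumulated a t \<omega>) \<partial>M) = 
     (\<integral>\<^sup>+\<omega>. (\<Sum>n. G \<omega> * ordered_integral (\<lambda>s. rate s \<omega>) t n a) \<partial>M)"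
    by (intro nn_integral_cong)
      (simp add: accumulated_def suminf_ordered_integral[symmetric] measurable_rate_time)
  also have "\<dots> = (\<Sum>n. \<integral>\<^sup>+\<omega>. G \<omega> * ordered_integral (\<lambda>s. rate s \<omega>) t n a \<partial>M)"
    by (intro nn_integral_suminf) measurable
  also have "\<dots> = (\<Sum>n. \<integral>\<^sup>+\<omega>. G \<omega> * dyson P V n (t - a) (X a \<omega>) \<partial>M)"
    by (simp add: nn_integral_ordered_integral assms)
  also have "\<dots> = (\<integral>\<^sup>+\<omega>. (\<Sum>n. G \<omega> * dyson P V n (t - a) (X a \<omega>)) \<partial>M)"
    by (intro nn_integral_suminf[symmetric]) measurable
  finally show ?thesis by (simp add: dyson_sum_def)
qed

text \<open>
  If \<open>D\<close> and \<open>D'\<close> have the same integrals against functions of the past up to time \<open>a\<close>, they may also be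
  exchanged next to powers of the reward accumulated before \<open>a\<close>. This is not a special case, because the
  integrated reward need not be measurable for the natural filtration. Writing one factor as a time
  integral and taking that integral outside leaves the factor \<open>V(X\<^sub>s)\<close>, which is.
\<close>

lemma nn_integral_power_accumulated_cong:
  assumes a: "0 \<le> a" and [measurable]: "D \<in> borel_measurable M" "D' \<in> borel_measurable M"
    and eq: "\<And>G. G \<in> borel_measurable (natural_filtration M X a) \<Longrightarrow>
      (\<integral>\<^sup>+\<omega>. G \<omega> * D \<omega> \<partial>M) = (\<integral>\<^sup>+\<omega>. G \<omega> * D' \<omega> \<partial>M)"
    and G: "G \<in> borel_measurable (natural_filtration M X a)"
  shows "(\<integral>\<^sup>+\<omega>. G \<omega> * (accumulated 0 a \<omega> ^ n * D \<omega>) \<partial>M) = (\<integral>\<^sup>+\<omega>. G \<omega> * (accumulated 0 a \<omega> ^ n * D' \<omega>) \<partial>M)"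
  using G
proof (induction n arbitrary: G)
  case (Suc n)
  note [measurable] = measurable_natural[OF Suc.prems] measurable_rate_state
  have *: "(\<integral>\<^sup>+\<omega>. G \<omega> * (accumulated 0 a \<omega> ^ Suc n * E \<omega>) \<partial>M) =
    (\<integral>\<^sup>+s. \<integral>\<^sup>+\<omega>. indicator {0..a} s * ((G \<omega> * rate s \<omega>) * (accumulated 0 a \<omega> ^ n * E \<omega>)) \<partial>M \<partial>lborel)"
    if [measurable]: "E \<in> borel_measurable M" for E
  proof -
    have "(\<integral>\<^sup>+\<omega>. G \<omega> * (accumulated 0 a \<omega> ^ Suc n * E \<omega>) \<partial>M) =
      (\<integral>\<^sup>+\<omega>. \<integral>\<^sup>+s. indicator {0..a} s * ((G \<omega> * rate s \<omega>) * (accumulated 0 a \<omega> ^ n * E \<omega>)) \<partial>lborel \<partial>M)"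
    proof (rule nn_integral_cong)
      fix \<omega> assume \<omega>: "\<omega> \<in> space M"
      have "G \<omega> * (accumulated 0 a \<omega> ^ Suc n * E \<omega>) = (G \<omega> * (accumulated 0 a \<omega> ^ n * E \<omega>)) * accumulated 0 a \<omega>"
        by (simp add: ac_simps)
      also have "\<dots> = (\<integral>\<^sup>+s. (G \<omega> * (accumulated 0 a \<omega> ^ n * E \<omega>)) * (indicator {0..a} s * rate s \<omega>) \<partial>lborel)"
        unfolding accumulated_def[of 0 a \<omega>] using measurable_rate_time[OF \<omega>]
        by (subst nn_integral_cmult) auto
      finally show "G \<omega> * (accumulated 0 a \<omega> ^ Suc n * E \<omega>) =
        (\<integral>\<^sup>+s. indicator {0..a} s * ((G \<omega> * rate s \<omega>) * (accumulated 0 a \<omega> ^ n * E \<omega>)) \<partial>lborel)"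
        by (simp add: ac_simps)
    qed
    also have "\<dots> = (\<integral>\<^sup>+s. \<integral>\<^sup>+\<omega>. indicator {0..a} s * ((G \<omega> * rate s \<omega>) * (accumulated 0 a \<omega> ^ n * E \<omega>)) \<partial>M \<partial>lborel)"
      by (rule Fubini'[symmetric]) (simp add: split_beta')
    finally show ?thesis .
  qed
  show ?case unfolding *[OF assms(2)] *[OF assms(3)]
  proof (rule nn_integral_cong)
    fix s :: real
    show "(\<integral>\<^sup>+\<omega>. indicator {0..a} s * ((G \<omega> * rate s \<omega>) * (accumulated 0 a \<omega> ^ n * D \<omega>)) \<partial>M) =
      (\<integral>\<^sup>+\<omega>. indicator {0..a} s * ((G \<omega> * rate s \<omega>) * (accumulated 0 a \<omega> ^ n * D' \<omega>)) \<partial>M)"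
    proof (cases "s \<in> {0..a}")
      case True
      then have s: "0 \<le> s" "s \<le> a" "max 0 s = s" by auto
      have "(\<lambda>\<omega>. G \<omega> * rate s \<omega>) \<in> borel_measurable (natural_filtration M X a)"
        unfolding rate_def s(3)
        using Suc.prems measurable_compose[OF measurable_natural_filtration[OF s(1,2), of X M] V] by simp
      from Suc.IH[OF this] True show ?thesis by simp
    qed simp
  qed
qed (use eq in simp)

text \<open>
  The semigroup property: the future factor is replaced by its Dyson series at the state \<open>X\<^sub>a\<close>, term by
  term in the power series of the past factor.
\<close>

lemma nn_integral_exp_accumulated_split:
  assumes a: "0 \<le> a" "a \<le> t"
  shows "(\<integral>\<^sup>+\<omega>. ennreal_exp (accumulated 0 a \<omega>) * ennreal_exp (accumulated a t \<omega>) \<partial>M) =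
    (\<integral>\<^sup>+\<omega>. ennreal_exp (accumulated 0 a \<omega>) * dyson_sum P V (t - a) (X a \<omega>) \<partial>M)"
proof -
  note [measurable] = measurable_dyson_sum[OF transition V]
  have [measurable]: "X a \<in> M \<rightarrow>\<^sub>M borel" using a by simp
  have *: "(\<integral>\<^sup>+\<omega>. ennreal_exp (accumulated 0 a \<omega>) * E \<omega> \<partial>M) =
    (\<Sum>n. \<integral>\<^sup>+\<omega>. 1 / fact n * (accumulated 0 a \<omega> ^ n * E \<omega>) \<partial>M)"
    if [measurable]: "E \<in> borel_measurable M" for E
    by (subst nn_integral_suminf[symmetric], measurable)
       (simp add: ennreal_exp_def divide_ennreal_def ac_simps flip: ennreal_suminf_cmult)
  have "(\<integral>\<^sup>+\<omega>. 1 / fact n * (accumulated 0 a \<omega> ^ n * ennreal_exp (accumulated a t \<omega>)) \<partial>M) =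
    (\<integral>\<^sup>+\<omega>. 1 / fact n * (accumulated 0 a \<omega> ^ n * dyson_sum P V (t - a) (X a \<omega>)) \<partial>M)" for n
    by (rule nn_integral_power_accumulated_cong[OF a(1)]) (auto intro!: nn_integral_exp_accumulated a)
  then show ?thesis by (subst (1 2) *) auto
qed

lemma dyson_sum_eq:
  assumes "0 \<le> t"
  shows "dyson_sum P V t x = (\<integral>\<^sup>+\<omega>. ennreal_exp (accumulated 0 t \<omega>) \<partial>M)"
proof -
  have "(\<integral>\<^sup>+\<omega>. ennreal_exp (accumulated 0 t \<omega>) \<partial>M) = (\<integral>\<^sup>+\<omega>. dyson_sum P V t (X 0 \<omega>) \<partial>M)"
    using nn_integral_exp_accumulated[of 0 t "\<lambda>_. 1"] assms by simp
  also have "\<dots> = (\<integral>\<^sup>+\<omega>. dyson_sum P V t x \<partial>M)"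
  proof (rule nn_integral_cong_AE)
    have "AE \<omega> in M. X 0 \<omega> = x" using markov by (simp add: markov_process_def)
    then show "AE \<omega> in M. dyson_sum P V t (X 0 \<omega>) = dyson_sum P V t x" by eventually_elim simp
  qed
  finally show ?thesis by (simp add: emeasure_space_1)
qed

end

section \<open>Exponentially tilted Markov chains\<close>

lemma measurable_kernel_power:
  assumes "K \<in> borel \<rightarrow>\<^sub>M prob_algebra borel"
  shows "kernel_power K n \<in> borel \<rightarrow>\<^sub>M prob_algebra borel"
proof (induction n)
  case 0
  have "kernel_power K 0 = return borel" by (rule ext) simp
  then show ?case by simp
next
  case (Suc n)
  have "kernel_power K (Suc n) = (\<lambda>x. K x \<bind> kernel_power K n)" by (rule ext) simp
  then show ?case using measurable_bind_prob_space[OF assms Suc] by simp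
qed

lemma kernel_power_1:
  assumes "K \<in> borel \<rightarrow>\<^sub>M prob_algebra borel"
  shows "kernel_power K 1 x = K x"
proof -
  have "kernel_power K 0 = return borel" by (rule ext) simp
  moreover have "sets (K x) = sets borel"
    using measurable_space[OF assms, of x] by (auto simp: space_prob_algebra)
  ultimately show ?thesis by (simp add: bind_return'')
qed

lemma nn_integral_le_scaled:
  assumes "prob_space \<mu>" "prob_space \<nu>" "sets \<mu> = sets \<nu>" "0 \<le> \<kappa>"
    and "\<And>B. B \<in> sets \<mu> \<Longrightarrow> measure \<mu> B \<le> \<kappa> * measure \<nu> B"
    and f: "f \<in> borel_measurable \<nu>"
  shows "(\<integral>\<^sup>+x. f x \<partial>\<mu>) \<le> ennreal \<kappa> * (\<integral>\<^sup>+x. f x \<partial>\<nu>)"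
proof -
  interpret \<mu>: prob_space \<mu> by fact
  interpret \<nu>: prob_space \<nu> by fact
  have "\<mu> \<le> scale_measure (ennreal \<kappa>) \<nu>"
    using assms by (subst le_measure) (auto simp: \<mu>.emeasure_eq_measure \<nu>.emeasure_eq_measure ennreal_mult' [symmetric])
  then have "(\<integral>\<^sup>+x. f x \<partial>\<mu>) \<le> (\<integral>\<^sup>+x. f x \<partial>scale_measure (ennreal \<kappa>) \<nu>)"
    using assms(3) by (intro nn_integral_mono_measure) auto
  also have "\<dots> = ennreal \<kappa> * (\<integral>\<^sup>+x. f x \<partial>\<nu>)"
    using f by (rule nn_integral_scale_measure)
  finally show ?thesis .
qed

text \<open>
  One step of the discrete Feynman-Kac semigroup: the reward of the current state is collected before
  the transition.
\<close>

definition tilted_step :: "('e \<Rightarrow> 'e measure) \<Rightarrow> ('e \<Rightarrow> real) \<Rightarrow> ('e \<Rightarrow> ennreal) \<Rightarrow> 'e \<Rightarrow> ennreal" where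
  "tilted_step K w f x = ennreal (exp (w x)) * (\<integral>\<^sup>+y. f y \<partial>K x)"

locale tilted_kernel =
  fixes K :: "'e \<Rightarrow> 'e::topological_space measure" and w :: "'e \<Rightarrow> real" and b :: real
  assumes K: "K \<in> borel \<rightarrow>\<^sub>M prob_algebra borel"
    and w[measurable]: "w \<in> borel_measurable borel"
    and w_bound: "\<bar>w x\<bar> \<le> b"
begin

abbreviation "L \<equiv> tilted_step K w"

lemma measurable_K[measurable]: "K \<in> borel \<rightarrow>\<^sub>M subprob_algebra borel"
  using K by (rule measurable_prob_algebraD)

lemma prob_space_kernel_power: "prob_space (kernel_power K n x)"
  and sets_kernel_power[measurable_cong]: "sets (kernel_power K n x) = sets borel"
  using measurable_space[OF measurable_kernel_power[OF K], of x n] by (auto simp: space_prob_algebra)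

lemma sets_K[measurable_cong]: "sets (K x) = sets borel"
  using measurable_space[OF K, of x] by (auto simp: space_prob_algebra)

lemma steps_Suc: "(L ^^ Suc n) f x = ennreal (exp (w x)) * (\<integral>\<^sup>+y. (L ^^ n) f y \<partial>K x)"
  by (simp add: tilted_step_def[of K w "(L ^^ n) f"])

lemma measurable_step[measurable]: "f \<in> borel_measurable borel \<Longrightarrow> L f \<in> borel_measurable borel"
proof -
  assume [measurable]: "f \<in> borel_measurable borel"
  have "(\<lambda>x. integral\<^sup>N (K x) f) \<in> borel_measurable borel"
    by (rule nn_integral_measurable_subprob_algebra2[where N=borel]) auto
  then show ?thesis unfolding tilted_step_def[abs_def] by measurable
qed

lemma measurable_steps[measurable]: "f \<in> borel_measurable borel \<Longrightarrow> (L ^^ n) f \<in> borel_measurable borel"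
  by (induction n) auto

text \<open>
  The Markov property at time \<open>n\<close> turns the last transition into one application of the
  operator to \<open>f\<close>, which therefore enters innermost.
\<close>

lemma nn_integral_chain:
  assumes markov: "markov_process (kernel_power K) x M Y" and f: "f \<in> borel_measurable borel"
  shows "(\<integral>\<^sup>+\<omega>. ennreal (exp (\<Sum>i<n. w (Y i \<omega>))) * f (Y n \<omega>) \<partial>M) = (L ^^ n) f x"
  using f
proof (induction n arbitrary: f)
  case 0
  interpret prob_space M using markov by (simp add: markov_process_def)
  have "AE \<omega> in M. Y 0 \<omega> = x" using markov by (simp add: markov_process_def)
  then have "(\<integral>\<^sup>+\<omega>. f (Y 0 \<omega>) \<partial>M) = (\<integral>\<^sup>+\<omega>. f x \<partial>M)"
    by (intro nn_integral_cong_AE) auto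
  then show ?case by (simp add: emeasure_space_1)
next
  case (Suc n)
  note [measurable] = Suc.prems
  have Yn: "Y i \<in> natural_filtration M Y n \<rightarrow>\<^sub>M borel" if "i \<le> n" for i
    using that by (intro measurable_natural_filtration) auto
  have G: "(\<lambda>\<omega>. ennreal (exp (\<Sum>i<Suc n. w (Y i \<omega>)))) \<in> borel_measurable (natural_filtration M Y n)"
    by (intro measurable_compose[OF _ measurable_ennreal] borel_measurable_exp[THEN measurable_compose_rev]
        measurable_compose[OF _ borel_measurable_exp] borel_measurable_sum measurable_compose[OF Yn w]) auto
  have "(\<integral>\<^sup>+\<omega>. ennreal (exp (\<Sum>i<Suc n. w (Y i \<omega>))) * f (Y (Suc n) \<omega>) \<partial>M) =
      (\<integral>\<^sup>+\<omega>. ennreal (exp (\<Sum>i<Suc n. w (Y i \<omega>))) * (\<integral>\<^sup>+y. f y \<partial>kernel_power K 1 (Y n \<omega>)) \<partial>M)"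
    using markov_process_nn_integral[OF markov _ _ measurable_kernel_power[OF K] G, of 1 f] by simp
  also have "\<dots> = (\<integral>\<^sup>+\<omega>. ennreal (exp (\<Sum>i<n. w (Y i \<omega>))) * L f (Y n \<omega>) \<partial>M)"
    unfolding kernel_power_1[OF K] tilted_step_def by (simp add: exp_add ennreal_mult mult.assoc)
  also have "\<dots> = (L ^^ n) (L f) x" by (rule Suc.IH) measurable
  finally show ?case by (simp add: funpow_swap1)
qed

text \<open>
  Tilting by weights between \<open>exp (- b)\<close> and \<open>exp b\<close> changes an \<open>n\<close>-step integral by at most
  \<open>exp (n b)\<close> in either direction. This transfers comparisons between the untilted transition laws to the
  tilted ones.
\<close>

lemma steps_le_kernel_power:
  assumes f[measurable]: "f \<in> borel_measurable borel"
  shows "(L ^^ n) f x \<le> ennreal (exp (real n * b)) * (\<integral>\<^sup>+y. f y \<partial>kernel_power K n x)"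
    and "(\<integral>\<^sup>+y. f y \<partial>kernel_power K n x) \<le> ennreal (exp (real n * b)) * (L ^^ n) f x"
proof (induction n arbitrary: x)
  case 0
  {
    case 1 show ?case by (simp add: nn_integral_return)
  next
    case 2 show ?case by (simp add: nn_integral_return)
  }
next
  case (Suc n)
  have kp: "kernel_power K n \<in> borel \<rightarrow>\<^sub>M subprob_algebra borel"
    using measurable_kernel_power[OF K] by (rule measurable_prob_algebraD)
  have bind: "(\<integral>\<^sup>+y. f y \<partial>kernel_power K (Suc n) x) = (\<integral>\<^sup>+z. \<integral>\<^sup>+y. f y \<partial>kernel_power K n z \<partial>K x)" for x
    using kp by (simp add: nn_integral_bind[OF f, of _ "K x"] sets_K cong: measurable_cong_sets)
  have [measurable]: "(\<lambda>z. \<integral>\<^sup>+y. f y \<partial>kernel_power K n z) \<in> borel_measurable borel"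
    by (rule nn_integral_measurable_subprob_algebra2[OF _ kp]) auto
  have w: "ennreal (exp (w x)) \<le> ennreal (exp b)" "1 \<le> ennreal (exp b) * ennreal (exp (w x))" for x
    using w_bound[of x] by (auto simp: ennreal_mult'[symmetric] exp_add[symmetric] simp flip: ennreal_1)
  have e: "ennreal (exp (real (Suc n) * b)) = ennreal (exp b) * ennreal (exp (real n * b))"
    by (simp add: ennreal_mult'[symmetric] exp_add[symmetric] algebra_simps)
  {
    case 1
    have "(L ^^ Suc n) f x = ennreal (exp (w x)) * (\<integral>\<^sup>+z. (L ^^ n) f z \<partial>K x)"
      by (rule steps_Suc)
    also have "\<dots> \<le> ennreal (exp b) * (\<integral>\<^sup>+z. ennreal (exp (real n * b)) * (\<integral>\<^sup>+y. f y \<partial>kernel_power K n z) \<partial>K x)"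
      by (intro mult_mono w nn_integral_mono Suc.IH) auto
    finally show ?case unfolding bind e by (simp add: nn_integral_cmult mult.assoc)
  next
    case 2
    have "(\<integral>\<^sup>+z. \<integral>\<^sup>+y. f y \<partial>kernel_power K n z \<partial>K x) \<le> (\<integral>\<^sup>+z. ennreal (exp (real n * b)) * (L ^^ n) f z \<partial>K x)"
      by (intro nn_integral_mono Suc.IH)
    also have "\<dots> = 1 * (ennreal (exp (real n * b)) * (\<integral>\<^sup>+z. (L ^^ n) f z \<partial>K x))"
      by (simp add: nn_integral_cmult)
    also have "\<dots> \<le> (ennreal (exp b) * ennreal (exp (w x))) * (ennreal (exp (real n * b)) * (\<integral>\<^sup>+z. (L ^^ n) f z \<partial>K x))"
      by (intro mult_right_mono w) auto
    finally show ?case unfolding bind e steps_Suc by (simp add: ac_simps)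
  }
qed

lemma steps_mono:
  assumes "\<And>y. f y \<le> g y" shows "(L ^^ n) f x \<le> (L ^^ n) g x"
  using assms by (induction n arbitrary: x) (auto simp: tilted_step_def intro!: mult_left_mono nn_integral_mono)

lemma steps_cmult:
  assumes [measurable]: "f \<in> borel_measurable borel"
  shows "(L ^^ n) (\<lambda>y. r * f y) x = r * (L ^^ n) f x"
proof (induction n arbitrary: x)
  case (Suc n)
  have "(\<integral>\<^sup>+y. (L ^^ n) (\<lambda>y. r * f y) y \<partial>K x) = (\<integral>\<^sup>+y. r * (L ^^ n) f y \<partial>K x)"
    by (simp add: Suc)
  then show ?case unfolding steps_Suc by (simp add: nn_integral_cmult ac_simps)
qed simp

definition "mass n x = (L ^^ n) (\<lambda>_. 1) x"

lemma mass_bounds: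
  "mass n x \<le> ennreal (exp (real n * b))" "1 \<le> ennreal (exp (real n * b)) * mass n x"
  using steps_le_kernel_power[of "\<lambda>_. 1" n x] prob_space.emeasure_space_1[OF prob_space_kernel_power]
  by (auto simp: mass_def)

lemma measurable_mass[measurable]: "mass n \<in> borel_measurable borel"
proof -
  have "(L ^^ n) (\<lambda>_. 1) \<in> borel_measurable borel" by measurable
  then show ?thesis by (simp add: mass_def[abs_def])
qed

lemma mass_add: "mass (n + j) x = (L ^^ n) (mass j) x"
  by (simp add: mass_def[abs_def] funpow_add)

text \<open>
  A Harnack inequality uniform in \<open>n\<close>. If \<open>n \<ge> N\<close>, the first \<open>N\<close> steps are compared through the untilted
  kernel, at the price of one factor \<open>exp (N b)\<close> on each side, and the remaining steps enter both sides
  as the same integrand. If \<open>n < N\<close>, the two-sided bounds on the mass suffice.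
\<close>

lemma mass_harnack:
  assumes \<kappa>: "\<And>x x' B. B \<in> sets borel \<Longrightarrow> 
      measure (kernel_power K N x) B \<le> \<kappa> * measure (kernel_power K N x') B"
  shows "mass n x \<le> ennreal (\<kappa> * exp (2 * (real N * b))) * mass n x'"
proof -
  have b: "0 \<le> b" using w_bound[of x] by simp
  have m1: "measure (kernel_power K N y) UNIV = 1" for y
    using prob_space.prob_space[OF prob_space_kernel_power] sets_eq_imp_space_eq[OF sets_kernel_power]
    by (metis space_borel)
  have \<kappa>1: "1 \<le> \<kappa>" using \<kappa>[of UNIV x x] by (simp add: m1)
  have e: "ennreal (\<kappa> * exp (2 * (real N * b))) = ennreal (exp (real N * b)) * (ennreal \<kappa> * ennreal (exp (real N * b)))"
    using \<kappa>1 by (simp add: ennreal_mult'[symmetric] ac_simps) (simp add: exp_add[symmetric])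
  show ?thesis
  proof (cases "N \<le> n")
    case True
    define g where "g = mass (n - N)"
    have [measurable]: "g \<in> borel_measurable borel" by (simp add: g_def)
    have g: "mass n y = (L ^^ N) g y" for y
      using mass_add[of N "n - N" y] True by (simp add: g_def)
    have "mass n x \<le> ennreal (exp (real N * b)) * (\<integral>\<^sup>+y. g y \<partial>kernel_power K N x)"
      unfolding g by (rule steps_le_kernel_power) measurable
    also have "(\<integral>\<^sup>+y. g y \<partial>kernel_power K N x) \<le> ennreal \<kappa> * (\<integral>\<^sup>+y. g y \<partial>kernel_power K N x')"
      using \<kappa>1 \<kappa> by (intro nn_integral_le_scaled prob_space_kernel_power) (auto simp: sets_kernel_power)
    also have "(\<integral>\<^sup>+y. g y \<partial>kernel_power K N x') \<le> ennreal (exp (real N * b)) * mass n x'"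
      unfolding g by (rule steps_le_kernel_power) measurable
    finally show ?thesis unfolding e by (simp add: mult_left_mono mult.assoc)
  next
    case False
    have le: "exp (real n * b) \<le> exp (real N * b)" using False b by (simp add: mult_right_mono)
    have "mass n x \<le> ennreal (exp (real n * b)) * 1" using mass_bounds(1) by simp
    also have "\<dots> \<le> ennreal (exp (real N * b)) * (ennreal \<kappa> * (ennreal (exp (real n * b)) * mass n x'))"
    proof (rule mult_mono)
      show "1 \<le> ennreal \<kappa> * (ennreal (exp (real n * b)) * mass n x')"
        using mult_mono[of 1 "ennreal \<kappa>" 1 "ennreal (exp (real n * b)) * mass n x'"] \<kappa>1 mass_bounds(2)[of n x']
        by simp
    qed (use le in auto)
    also have "\<dots> \<le> ennreal (exp (real N * b)) * (ennreal \<kappa> * (ennreal (exp (real N * b)) * mass n x'))"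
      using le by (intro mult_left_mono mult_right_mono) auto
    finally show ?thesis unfolding e by (simp add: mult.assoc)
  qed
qed

lemma mass_finite: "mass n x \<noteq> \<top>" "mass n x \<noteq> 0"
  using mass_bounds[of n x] by (auto simp: top_unique)

text \<open>
  The mass after \<open>n + j\<close> steps is the \<open>n\<close>-step operator applied to the mass after \<open>j\<close> steps, and the
  Harnack inequality allows the latter to be replaced by its value at \<open>x\<close>, up to a constant factor.
\<close>

lemma ln_mass_almost_additive:
  assumes \<kappa>: "\<And>x x' B. B \<in> sets borel \<Longrightarrow> 
      measure (kernel_power K N x) B \<le> \<kappa> * measure (kernel_power K N x') B"
  defines "r \<equiv> ln (\<kappa> * exp (2 * (real N * b)))"
  shows "\<bar>ln (enn2real (mass (n + j) x)) - ln (enn2real (mass n x)) - ln (enn2real (mass j x))\<bar> \<le> r"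
proof -
  define R where "R = \<kappa> * exp (2 * (real N * b))"
  define z where "z n = enn2real (mass n x)" for n
  have zm: "mass n x = ennreal (z n)" and zp: "0 < z n" for n
    using mass_finite[of n x] by (auto simp: z_def enn2real_positive_iff less_top[symmetric] zero_less_iff_neq_zero)
  have h: "mass n y \<le> ennreal R * mass n y'" for n y y'
    unfolding R_def by (rule mass_harnack[OF \<kappa>])
  have "0 < R"
  proof (rule ccontr)
    assume "\<not> 0 < R"
    then have "ennreal R = 0" by (simp add: ennreal_neg)
    with h[of 0 x x] show False using mass_finite[of 0 x] by auto
  qed
  have "ennreal (z (n + j)) \<le> ennreal (R * z n * z j)"
  proof -
    have "mass (n + j) x \<le> (L ^^ n) (\<lambda>y. (ennreal R * mass j x) * 1) x"
      unfolding mass_add using h by (intro steps_mono) simp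
    also have "\<dots> = ennreal R * mass j x * mass n x"
      by (subst steps_cmult) (auto simp: mass_def)
    finally show ?thesis using \<open>0 < R\<close> zp unfolding zm by (simp add: ennreal_mult'[symmetric] less_imp_le ac_simps)
  qed
  then have 1: "z (n + j) \<le> R * z n * z j"
    using \<open>0 < R\<close> zp[of n] zp[of j] by (subst (asm) ennreal_le_iff) auto
  have "ennreal (z n * z j) \<le> ennreal (R * z (n + j))"
  proof -
    have "mass j x * mass n x = (L ^^ n) (\<lambda>y. mass j x * 1) x"
      by (subst steps_cmult) (auto simp: mass_def)
    also have "\<dots> \<le> (L ^^ n) (\<lambda>y. ennreal R * mass j y) x"
      using h by (intro steps_mono) simp
    also have "\<dots> = ennreal R * mass (n + j) x"
      unfolding mass_add by (subst steps_cmult) auto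
    finally show ?thesis using \<open>0 < R\<close> zp unfolding zm by (simp add: ennreal_mult'[symmetric] less_imp_le ac_simps)
  qed
  then have 2: "z n * z j \<le> R * z (n + j)"
    using \<open>0 < R\<close> zp[of "n + j"] by (subst (asm) ennreal_le_iff) auto
  have "ln (z (n + j)) \<le> ln (R * z n * z j)" "ln (z n * z j) \<le> ln (R * z (n + j))"
    using 1 2 zp \<open>0 < R\<close> by (auto intro!: ln_mono)
  then show ?thesis
    using zp \<open>0 < R\<close> by (simp add: ln_mult less_imp_neq[symmetric] R_def[symmetric] r_def z_def[symmetric] abs_le_iff)
qed

end

section \<open>Integrals under convergence in variation\<close>

lemma variation_norm_bound:
  fixes \<mu> \<nu> :: "'e::topological_space measure"
  assumes "finite_measure \<mu>" "finite_measure \<nu>" "sets \<mu> = sets borel" "sets \<nu> = sets borel" and B: "B \<in> sets borel"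
  shows "\<bar>measure \<mu> B - measure \<nu> B\<bar> \<le> variation_norm (\<lambda>B. measure \<mu> B - measure \<nu> B)"
proof -
  interpret \<mu>: finite_measure \<mu> by fact
  interpret \<nu>: finite_measure \<nu> by fact
  let ?\<Pi> = "{\<P>. finite \<P> \<and> partition_on UNIV \<P> \<and> \<P> \<subseteq> sets (borel :: 'e measure)}"
  let ?s = "\<lambda>\<P>. \<Sum>A\<in>\<P>. \<bar>measure \<mu> A - measure \<nu> A\<bar>"
  have bdd: "bdd_above (?s ` ?\<Pi>)"
  proof (rule bdd_aboveI2)
    fix \<P> assume \<P>: "\<P> \<in> ?\<Pi>"
    then have d: "disjoint_family_on (\<lambda>A. A) \<P>"
      by (auto simp: partition_on_def disjoint_def disjoint_family_on_def)
    have "?s \<P> \<le> (\<Sum>A\<in>\<P>. measure \<mu> A + measure \<nu> A)"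
      by (intro sum_mono) (smt (verit) measure_nonneg)
    also have "\<dots> = measure \<mu> (\<Union>A\<in>\<P>. A) + measure \<nu> (\<Union>A\<in>\<P>. A)"
      using \<P> d assms(3,4) \<mu>.finite_measure_finite_Union[of \<P> "\<lambda>A. A"] \<nu>.finite_measure_finite_Union[of \<P> "\<lambda>A. A"]
      by (simp add: sum.distrib)
    also have "\<dots> \<le> measure \<mu> (space \<mu>) + measure \<nu> (space \<nu>)"
      by (intro add_mono \<mu>.bounded_measure \<nu>.bounded_measure)
    finally show "?s \<P> \<le> measure \<mu> (space \<mu>) + measure \<nu> (space \<nu>)" .
  qed
  \<comment> \<open>A partition has no empty block, so it must be removed when \<open>B\<close> or its complement is empty.\<close>
  define \<P> where "\<P> = {B, - B} - {{}}"
  have \<P>: "\<P> \<in> ?\<Pi>"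
    using B by (auto simp: \<P>_def partition_on_def disjoint_def)
  have "\<bar>measure \<mu> B - measure \<nu> B\<bar> \<le> ?s \<P>"
  proof (cases "B = {}")
    case False
    then show ?thesis by (intro member_le_sum[of B \<P>]) (auto simp: \<P>_def)
  qed (simp add: sum_nonneg)
  also have "\<dots> \<le> variation_norm (\<lambda>B. measure \<mu> B - measure \<nu> B)"
    unfolding variation_norm_def using \<P> bdd by (rule cSUP_upper)
  finally show ?thesis .
qed

text \<open>
  By the layer cake formula the integral of a function with values in \<open>[0, c]\<close> is an integral over the levels
  \<open>s\<close> between 0 and \<open>c\<close> of the measures of \<open>{s < g}\<close>, and each of these changes by at most \<open>\<epsilon>\<close>.
\<close>

lemma nn_integral_le_setwise:
  fixes \<mu> \<nu> :: "'e::topological_space measure"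
  assumes "finite_measure \<mu>" "finite_measure \<nu>" "sets \<mu> = sets borel" "sets \<nu> = sets borel"
    and \<epsilon>: "\<And>B. B \<in> sets borel \<Longrightarrow> measure \<mu> B \<le> measure \<nu> B + \<epsilon>"
    and g[measurable]: "g \<in> borel_measurable borel" and g0: "\<And>y. 0 \<le> g y" "\<And>y. g y \<le> c" and "0 \<le> \<epsilon>" "0 \<le> c"
  shows "(\<integral>\<^sup>+y. ennreal (g y) \<partial>\<mu>) \<le> (\<integral>\<^sup>+y. ennreal (g y) \<partial>\<nu>) + ennreal (c * \<epsilon>)"
proof -
  have layer: "(\<integral>\<^sup>+y. ennreal (g y) \<partial>\<rho>) = (\<integral>\<^sup>+s. indicator {0..c} s * emeasure \<rho> {y. s < g y} \<partial>lborel)"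
    if "finite_measure \<rho>" "sets \<rho> = sets borel" for \<rho> :: "'e measure"
  proof -
    interpret finite_measure \<rho> by fact
    interpret pair_sigma_finite \<rho> lborel ..
    note [measurable_cong] = that(2)
    have "(\<integral>\<^sup>+y. ennreal (g y) \<partial>\<rho>) = (\<integral>\<^sup>+y. \<integral>\<^sup>+s. indicator {0..c} s * indicator {y. s < g y} y \<partial>lborel \<partial>\<rho>)"
    proof (rule nn_integral_cong)
      fix y
      have "(\<integral>\<^sup>+s. indicator {0..c} s * indicator {y. s < g y} y \<partial>lborel) = (\<integral>\<^sup>+s. indicator {0..<g y} s \<partial>lborel)"
        using g0(2)[of y] by (intro nn_integral_cong) (auto simp: indicator_def)
      then show "ennreal (g y) = (\<integral>\<^sup>+s. indicator {0..c} s * indicator {y. s < g y} y \<partial>lborel)"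
        using g0(1)[of y] by simp
    qed
    also have "\<dots> = (\<integral>\<^sup>+s. \<integral>\<^sup>+y. indicator {0..c} s * indicator {y. s < g y} y \<partial>\<rho> \<partial>lborel)"
    proof (rule Fubini'[symmetric])
      show "(\<lambda>(y, s). indicator {0..c} s * indicator {y. s < g y} y :: ennreal) \<in> borel_measurable (\<rho> \<Otimes>\<^sub>M lborel)"
        by (auto simp: indicator_def split_beta' cong: if_cong)
    qed
    also have "\<dots> = (\<integral>\<^sup>+s. indicator {0..c} s * emeasure \<rho> {y. s < g y} \<partial>lborel)"
      by (intro nn_integral_cong, subst nn_integral_cmult) (auto simp: that(2))
    finally show ?thesis .
  qed
  interpret \<mu>: finite_measure \<mu> by fact
  interpret \<nu>: finite_measure \<nu> by fact
  interpret pair_sigma_finite \<nu> lborel ..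
  note [measurable_cong] = assms(3,4)
  have m: "(\<lambda>s. emeasure \<nu> {y. s < g y}) \<in> borel_measurable lborel"
  proof -
    have "{z. snd z < g (fst z)} \<in> sets (\<nu> \<Otimes>\<^sub>M lborel)"
    proof -
      have "{z \<in> space (\<nu> \<Otimes>\<^sub>M lborel). snd z < g (fst z)} \<in> sets (\<nu> \<Otimes>\<^sub>M lborel)" by measurable
      then show ?thesis using sets_eq_imp_space_eq[OF assms(4)] by (simp add: space_pair_measure)
    qed
    from measurable_emeasure_Pair2[OF this] show ?thesis by (simp add: vimage_def)
  qed
  have "(\<integral>\<^sup>+y. ennreal (g y) \<partial>\<mu>) \<le> (\<integral>\<^sup>+s. indicator {0..c} s * emeasure \<nu> {y. s < g y} + ennreal \<epsilon> * indicator {0..c} s \<partial>lborel)"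
    unfolding layer[OF assms(1,3)]
  proof (rule nn_integral_mono)
    fix s
    have "ennreal (measure \<mu> {y. s < g y}) \<le> ennreal (measure \<nu> {y. s < g y}) + ennreal \<epsilon>"
      using \<epsilon>[of "{y. s < g y}"] \<open>0 \<le> \<epsilon>\<close> by (simp flip: ennreal_plus)
    then show "indicator {0..c} s * emeasure \<mu> {y. s < g y} \<le> 
        indicator {0..c} s * emeasure \<nu> {y. s < g y} + ennreal \<epsilon> * indicator {0..c} s"
      by (auto simp: indicator_def \<mu>.emeasure_eq_measure \<nu>.emeasure_eq_measure)
  qed
  also have "\<dots> = (\<integral>\<^sup>+s. indicator {0..c} s * emeasure \<nu> {y. s < g y} \<partial>lborel) + (\<integral>\<^sup>+s. ennreal \<epsilon> * indicator {0..c} s \<partial>lborel)"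
    using m by (intro nn_integral_add) auto
  also have "(\<integral>\<^sup>+s. ennreal \<epsilon> * indicator {0..c} s \<partial>lborel) = ennreal (c * \<epsilon>)"
    using \<open>0 \<le> c\<close> \<open>0 \<le> \<epsilon>\<close> by (simp add: nn_integral_cmult_indicator ennreal_mult' mult.commute)
  finally show ?thesis unfolding layer[OF assms(2,4)] .
qed

text \<open>
  Changing the measure costs at most \<open>c\<close> times the variation distance, uniformly over integrands bounded by
  \<open>c\<close>, so the integrand may vary with \<open>m\<close> as well. For the fixed limit measure, dominated
  convergence applies.
\<close>

lemma nn_integral_tendsto_variation:
  fixes \<mu> :: "nat \<Rightarrow> 'e::topological_space measure"
  assumes fin: "\<And>m. finite_measure (\<mu> m)" "finite_measure \<nu>" 
    and sets: "\<And>m. sets (\<mu> m) = sets borel" "sets \<nu> = sets borel"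
    and var: "(\<lambda>m. variation_norm (\<lambda>B. measure (\<mu> m) B - measure \<nu> B)) \<longlonglongrightarrow> 0"
    and f[measurable]: "\<And>m. f m \<in> borel_measurable borel" and "g \<in> borel_measurable borel"
    and bound: "\<And>m y. f m y \<le> ennreal c" and "0 \<le> c"
    and lim: "\<And>y. (\<lambda>m. f m y) \<longlonglongrightarrow> g y"
  shows "(\<lambda>m. \<integral>\<^sup>+y. f m y \<partial>\<mu> m) \<longlonglongrightarrow> (\<integral>\<^sup>+y. g y \<partial>\<nu>)"
proof -
  interpret \<nu>: finite_measure \<nu> by fact
  define \<epsilon> where "\<epsilon> m = variation_norm (\<lambda>B. measure (\<mu> m) B - measure \<nu> B)" for m
  note vb = variation_norm_bound[OF fin(1) fin(2) sets(1) sets(2), folded \<epsilon>_def]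
  have \<epsilon>0: "0 \<le> \<epsilon> m" for m using vb[of "{}" m] by simp
  have fe: "f m y = ennreal (enn2real (f m y))" for m y
    using bound[of m y] by (metis ennreal_enn2real ennreal_less_top le_less_trans)
  have fr: "enn2real (f m y) \<le> c" for m y
    using bound[of m y] \<open>0 \<le> c\<close> by (simp add: enn2real_leI)
  have up: "(\<integral>\<^sup>+y. f m y \<partial>\<mu> m) \<le> (\<integral>\<^sup>+y. f m y \<partial>\<nu>) + ennreal (c * \<epsilon> m)" for m
  proof -
    have "(\<integral>\<^sup>+y. ennreal (enn2real (f m y)) \<partial>\<mu> m) \<le> (\<integral>\<^sup>+y. ennreal (enn2real (f m y)) \<partial>\<nu>) + ennreal (c * \<epsilon> m)"
      by (rule nn_integral_le_setwise)
        (use fin sets vb[of _ m] fr \<epsilon>0 \<open>0 \<le> c\<close> in \<open>auto simp: abs_le_iff algebra_simps\<close>)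
    then show ?thesis by (simp flip: fe)
  qed
  have lo: "(\<integral>\<^sup>+y. f m y \<partial>\<nu>) \<le> (\<integral>\<^sup>+y. f m y \<partial>\<mu> m) + ennreal (c * \<epsilon> m)" for m
  proof -
    have "(\<integral>\<^sup>+y. ennreal (enn2real (f m y)) \<partial>\<nu>) \<le> (\<integral>\<^sup>+y. ennreal (enn2real (f m y)) \<partial>\<mu> m) + ennreal (c * \<epsilon> m)"
      by (rule nn_integral_le_setwise)
        (use fin sets vb[of _ m] fr \<epsilon>0 \<open>0 \<le> c\<close> in \<open>auto simp: abs_le_iff algebra_simps\<close>)
    then show ?thesis by (simp flip: fe)
  qed
  have \<epsilon>lim: "(\<lambda>m. ennreal (c * \<epsilon> m)) \<longlonglongrightarrow> 0"
  proof -
    have "(\<lambda>m. c * \<epsilon> m) \<longlonglongrightarrow> c * 0" using var unfolding \<epsilon>_def by (intro tendsto_intros)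
    from tendsto_ennrealI[OF this] show ?thesis by simp
  qed
  note [measurable_cong] = sets(2)
  have "(\<integral>\<^sup>+y. ennreal c \<partial>\<nu>) < \<top>"
    by (simp add: \<nu>.emeasure_eq_measure ennreal_mult_less_top)
  then have base: "(\<lambda>m. \<integral>\<^sup>+y. f m y \<partial>\<nu>) \<longlonglongrightarrow> (\<integral>\<^sup>+y. g y \<partial>\<nu>)"
    by (intro nn_integral_dominated_convergence[where w="\<lambda>_. ennreal c"]) (use assms in auto)
  show ?thesis
  proof (rule tendsto_sandwich)
    show "\<forall>\<^sub>F m in sequentially. (\<integral>\<^sup>+y. f m y \<partial>\<nu>) - ennreal (c * \<epsilon> m) \<le> (\<integral>\<^sup>+y. f m y \<partial>\<mu> m)"
      using lo by (auto intro!: always_eventually simp: ennreal_minus_le_iff add.commute)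
    show "\<forall>\<^sub>F m in sequentially. (\<integral>\<^sup>+y. f m y \<partial>\<mu> m) \<le> (\<integral>\<^sup>+y. f m y \<partial>\<nu>) + ennreal (c * \<epsilon> m)"
      using up by simp
    show "(\<lambda>m. (\<integral>\<^sup>+y. f m y \<partial>\<nu>) + ennreal (c * \<epsilon> m)) \<longlonglongrightarrow> (\<integral>\<^sup>+y. g y \<partial>\<nu>)"
      using tendsto_add[OF base \<epsilon>lim] by simp
    show "(\<lambda>m. (\<integral>\<^sup>+y. f m y \<partial>\<nu>) - ennreal (c * \<epsilon> m)) \<longlonglongrightarrow> (\<integral>\<^sup>+y. g y \<partial>\<nu>)"
      using tendsto_diff_ennreal_general[OF base \<epsilon>lim] by simp
  qed
qed

section \<open>Almost additive sequences and growth rates\<close>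

text \<open>
  Comparing \<open>z (k n)\<close> with \<open>k z n\<close> and with \<open>n z k\<close> shows that \<open>z n / n\<close> is a Cauchy sequence; its limit is
  the slope \<open>l\<close>. Letting \<open>k \<rightarrow> \<infinity>\<close> in the same comparison bounds the error of \<open>z n / n\<close> by \<open>r / n\<close>.
\<close>

lemma almost_additive_linear:
  fixes z :: "nat \<Rightarrow> real"
  assumes z: "\<And>n j. \<bar>z (n + j) - z n - z j\<bar> \<le> r"
  obtains l where "\<And>n. \<bar>z n - real n * l\<bar> \<le> r"
proof -
  have r0: "0 \<le> r" using z[of 0 0] by linarith
  have mult: "\<bar>z (k * n) - real k * z n\<bar> \<le> (real k + 1) * r" for k n
  proof (induction k)
    case 0
    show ?case using z[of 0 0] by simp
  next
    case (Suc k)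
    have "\<bar>z (n + k * n) - z n - z (k * n)\<bar> \<le> r" by (rule z)
    with Suc show ?case by (simp add: algebra_simps abs_le_iff)
  qed
  have quot: "\<bar>z n / n - z k / k\<bar> \<le> (1 + 1 / k) * (r / n) + (1 + 1 / n) * (r / k)" if "0 < n" "0 < k" for n k
  proof -
    have "\<bar>z (k * n) - real k * z n\<bar> \<le> (real k + 1) * r" "\<bar>z (k * n) - real n * z k\<bar> \<le> (real n + 1) * r"
      using mult[of k n] mult[of n k] by (auto simp: mult.commute)
    then have "\<bar>real k * z n - real n * z k\<bar> \<le> (real k + 1) * r + (real n + 1) * r" by linarith
    then have "\<bar>real k * z n - real n * z k\<bar> / (real n * real k) \<le> ((real k + 1) * r + (real n + 1) * r) / (real n * real k)"
      using that by (intro divide_right_mono) auto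
    moreover have "\<bar>real k * z n - real n * z k\<bar> / (real n * real k) = \<bar>z n / n - z k / k\<bar>"
      using that by (simp add: abs_divide[symmetric] field_simps flip: abs_mult)
    moreover have "((real k + 1) * r + (real n + 1) * r) / (real n * real k) = (1 + 1 / k) * (r / n) + (1 + 1 / n) * (r / k)"
      using that by (simp add: field_simps)
    ultimately show ?thesis by simp
  qed
  have "Cauchy (\<lambda>n. z n / n)"
  proof (rule metric_CauchyI)
    fix e :: real assume "0 < e"
    define N where "N = Suc (nat \<lceil>4 * r / e\<rceil>)"
    have N: "4 * r / e < real N" unfolding N_def by linarith
    have *: "(1 + 1 / real k) * (r / n) < e / 2" if "N \<le> n" "N \<le> k" for n k
    proof -
      have nk: "0 < n" "0 < k" "4 * r / e < real n" using that N by (auto simp: N_def)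
      have "(1 + 1 / real k) * (r / n) \<le> 2 * (r / n)"
        using nk r0 by (intro mult_right_mono) auto
      also have "\<dots> < e / 2" using nk \<open>0 < e\<close> by (simp add: field_simps)
      finally show ?thesis .
    qed
    show "\<exists>N. \<forall>n\<ge>N. \<forall>k\<ge>N. dist (z n / n) (z k / k) < e"
    proof (intro exI[of _ N] allI impI)
      fix n k assume nk: "N \<le> n" "N \<le> k"
      then have "0 < n" "0 < k" by (auto simp: N_def)
      from quot[OF this] *[OF nk] *[OF nk(2,1)] show "dist (z n / n) (z k / k) < e"
        unfolding dist_real_def by linarith
    qed
  qed
  then obtain l where l: "(\<lambda>n. z n / n) \<longlonglongrightarrow> l" using convergent_eq_Cauchy by blast
  show thesis
  proof
    fix n
    show "\<bar>z n - real n * l\<bar> \<le> r"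
    proof (cases "n = 0")
      case True then show ?thesis using z[of 0 0] by simp
    next
      case False
      then have n: "0 < n" by simp
      have "(\<lambda>k. (1 + 1 / real k) * (r / n) + (1 + 1 / n) * (r / k)) \<longlonglongrightarrow> (1 + 0) * (r / n) + (1 + 1 / n) * 0"
        by (intro tendsto_intros lim_1_over_n lim_const_over_n)
      moreover have "(\<lambda>k. \<bar>z n / n - z k / k\<bar>) \<longlonglongrightarrow> \<bar>z n / n - l\<bar>"
        by (intro tendsto_intros l)
      ultimately have "\<bar>z n / n - l\<bar> \<le> (1 + 0) * (r / n) + (1 + 1 / n) * 0"
        by (rule tendsto_le[OF sequentially_bot]) 
           (use quot[OF n] in \<open>auto intro!: eventually_sequentiallyI[of 1]\<close>)
      then have "\<bar>z n / n - l\<bar> * n \<le> r" using n by (simp add: field_simps)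
      moreover have "\<bar>z n / n - l\<bar> * n = \<bar>z n - real n * l\<bar>"
        using n by (simp add: abs_mult_pos' mult.commute[of _ "real n"] right_diff_distrib)
      ultimately show ?thesis by simp
    qed
  qed
qed

section \<open>Exponential moments of the integrated reward\<close>

text \<open>
  A running reward \<open>w\<close> of either sign becomes nonnegative after adding \<open>\<beta>\<close>, which multiplies the
  exponential moment at time \<open>t\<close> by \<open>exp (\<beta> t)\<close>; the results on nonnegative potentials then carry
  over.
\<close>

locale bounded_additive_functional =
  fixes P :: "real \<Rightarrow> 'e \<Rightarrow> 'e::topological_space measure" and x :: 'e
    and M :: "'w measure" and X :: "real \<Rightarrow> 'w \<Rightarrow> 'e" and w :: "'e \<Rightarrow> real" and \<beta> :: real
  assumes transition: "(\<lambda>(t, x). P t x) \<in> restrict_space borel {0..} \<Otimes>\<^sub>M borel \<rightarrow>\<^sub>M prob_algebra borel"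
    and markov: "markov_process P x M X"
    and paths: "(\<lambda>(t, \<omega>). X t \<omega>) \<in> restrict_space borel {0..} \<Otimes>\<^sub>M M \<rightarrow>\<^sub>M borel"
    and w[measurable]: "w \<in> borel_measurable borel"
    and w_bound: "\<bar>w y\<bar> \<le> \<beta>"
begin

sublocale additive_functional P x M X "\<lambda>y. ennreal (w y + \<beta>)"
  by unfold_locales (use transition markov paths in auto)

definition "reward a t \<omega> = (LBINT s:{a..t}. w (X s \<omega>))"

lemma reward_bound_accumulated:
  assumes a: "0 \<le> a" "a \<le> t" and \<omega>: "\<omega> \<in> space M"
  shows "\<bar>reward a t \<omega>\<bar> \<le> \<beta> * (t - a)"
    and "accumulated a t \<omega> = ennreal (reward a t \<omega> + \<beta> * (t - a))"
proof -
  have "(\<lambda>z. (max 0 (fst z), snd z)) \<in> borel \<Otimes>\<^sub>M M \<rightarrow>\<^sub>M restrict_space borel {0::real..} \<Otimes>\<^sub>M M"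
    by (intro measurable_Pair measurable_restrict_space2) auto
  from measurable_compose[OF this measurable_compose[OF paths w]]
  have [measurable]: "(\<lambda>(s, \<omega>). w (X (max 0 s) \<omega>)) \<in> borel_measurable (borel \<Otimes>\<^sub>M M)"
    by (simp add: split_beta')
  have [measurable]: "(\<lambda>s. w (X (max 0 s) \<omega>)) \<in> borel_measurable borel"
    using \<omega> by measurable
  let ?f = "\<lambda>s. indicator {a..t} s * w (X (max 0 s) \<omega>)"
  have f: "(\<lambda>s. indicator {a..t} s * w (X s \<omega>)) = ?f"
    using a by (auto simp: indicator_def max_def)
  have const: "integrable lborel (\<lambda>s. indicator {a..t} s * \<beta>)" "(LBINT s. indicator {a..t} s * \<beta>) = \<beta> * (t - a)"
    using a by auto
  have int: "integrable lborel ?f"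
    by (rule Bochner_Integration.integrable_bound[OF const(1)])
       (use w_bound in \<open>auto simp: abs_mult indicator_def intro: order_trans[OF _ abs_ge_self]\<close>)
  have pos: "0 \<le> w y + \<beta>" for y using w_bound[of y] by linarith
  have r: "reward a t \<omega> = integral\<^sup>L lborel ?f"
    unfolding reward_def set_lebesgue_integral_def by (simp add: f)
  show "\<bar>reward a t \<omega>\<bar> \<le> \<beta> * (t - a)"
    unfolding r const(2)[symmetric]
    by (rule order_trans[OF integral_abs_bound integral_mono[OF integrable_abs[OF int] const(1)]])
       (use w_bound in \<open>auto simp: abs_mult indicator_def\<close>)
  have "accumulated a t \<omega> = (\<integral>\<^sup>+s. ennreal (?f s + indicator {a..t} s * \<beta>) \<partial>lborel)"
    unfolding accumulated_def rate_def
    by (intro nn_integral_cong) (auto simp: indicator_def)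
  also have "\<dots> = ennreal (LBINT s. ?f s + indicator {a..t} s * \<beta>)"
    using pos int const(1) by (intro nn_integral_eq_integral) (auto simp: indicator_def intro!: AE_I2)
  also have "(LBINT s. ?f s + indicator {a..t} s * \<beta>) = reward a t \<omega> + \<beta> * (t - a)"
    unfolding r const(2)[symmetric] by (rule Bochner_Integration.integral_add[OF int const(1)])
  finally show "accumulated a t \<omega> = ennreal (reward a t \<omega> + \<beta> * (t - a))" .
qed

lemma reward_nonneg:
  assumes a: "0 \<le> a" "a \<le> t" and \<omega>: "\<omega> \<in> space M"
  shows "0 \<le> reward a t \<omega> + \<beta> * (t - a)"
  using reward_bound_accumulated(1)[OF assms] by linarith

lemma exp_reward:
  assumes a: "0 \<le> a" "a \<le> t" and \<omega>: "\<omega> \<in> space M"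
  shows "ennreal (exp (reward a t \<omega>)) = ennreal (exp (- (\<beta> * (t - a)))) * ennreal_exp (accumulated a t \<omega>)"
  unfolding reward_bound_accumulated(2)[OF assms] ennreal_exp_ennreal[OF reward_nonneg[OF assms]]
  by (simp add: ennreal_mult'[symmetric] exp_add[symmetric])

lemma accumulated_add:
  assumes "0 \<le> a" "a \<le> t" and \<omega>: "\<omega> \<in> space M"
  shows "accumulated 0 t \<omega> = accumulated 0 a \<omega> + accumulated a t \<omega>"
proof -
  note [measurable] = measurable_rate_time[OF \<omega>]
  have "accumulated 0 t \<omega> = (\<integral>\<^sup>+s. indicator {0..a} s * rate s \<omega> + indicator {a..t} s * rate s \<omega> \<partial>lborel)"
    unfolding accumulated_def
    by (rule nn_integral_cong_AE)
       (use AE_lborel_singleton[of a] in eventually_elim, use assms in \<open>auto simp: indicator_def\<close>)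
  also have "\<dots> = accumulated 0 a \<omega> + accumulated a t \<omega>"
    unfolding accumulated_def by (intro nn_integral_add) auto
  finally show ?thesis .
qed

lemma reward_add:
  assumes "0 \<le> a" "a \<le> t" and \<omega>: "\<omega> \<in> space M"
  shows "reward 0 t \<omega> = reward 0 a \<omega> + reward a t \<omega>"
proof -
  have t: "0 \<le> t" using assms by simp
  note nn = reward_nonneg[OF order_refl assms(1) \<omega>] reward_nonneg[OF order_refl t \<omega>] reward_nonneg[OF assms]
  have "ennreal (reward 0 t \<omega> + \<beta> * (t - 0)) = ennreal ((reward 0 a \<omega> + \<beta> * (a - 0)) + (reward a t \<omega> + \<beta> * (t - a)))"
    using accumulated_add[OF assms] nn unfolding reward_bound_accumulated(2)[OF order_refl assms(1) \<omega>]
      reward_bound_accumulated(2)[OF order_refl t \<omega>] reward_bound_accumulated(2)[OF assms]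
    by (simp add: ennreal_plus)
  then show ?thesis using nn by (simp add: algebra_simps)
qed

lemma measurable_reward[measurable]:
  assumes "0 \<le> a" "a \<le> t"
  shows "reward a t \<in> borel_measurable M"
proof -
  have "(\<lambda>\<omega>. enn2real (accumulated a t \<omega>) - \<beta> * (t - a)) \<in> borel_measurable M" by measurable
  moreover have "enn2real (accumulated a t \<omega>) - \<beta> * (t - a) = reward a t \<omega>" if "\<omega> \<in> space M" for \<omega>
    using reward_bound_accumulated(2)[OF assms that] reward_nonneg[OF assms that] by simp
  ultimately show ?thesis by (simp cong: measurable_cong)
qed

lemma integrable_exp_reward:
  assumes "0 \<le> t"
  shows "integrable M (\<lambda>\<omega>. exp (reward 0 t \<omega>))"
proof (rule integrable_const_bound)
  show "AE \<omega> in M. norm (exp (reward 0 t \<omega>)) \<le> exp (\<beta> * t)"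
    using reward_bound_accumulated(1)[OF order_refl assms] by (auto simp: abs_le_iff intro!: AE_I2)
  show "(\<lambda>\<omega>. exp (reward 0 t \<omega>)) \<in> borel_measurable M"
    using measurable_reward[OF order_refl assms] by measurable
qed

definition "expected_reward t = (LINT \<omega>|M. exp (reward 0 t \<omega>))"

lemma expected_reward_eq_nn_integral:
  assumes "0 \<le> t"
  shows "ennreal (expected_reward t) = (\<integral>\<^sup>+\<omega>. ennreal (exp (reward 0 t \<omega>)) \<partial>M)"
  unfolding expected_reward_def
  by (rule nn_integral_eq_integral[symmetric, OF integrable_exp_reward[OF assms]]) auto

lemma expected_reward_pos:
  assumes "0 \<le> t" shows "0 < expected_reward t"
proof -
  have "exp (- (\<beta> * t)) = (LINT \<omega>|M. exp (- (\<beta> * t)))" by (simp add: prob_space)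
  also have "\<dots> \<le> expected_reward t"
    unfolding expected_reward_def using reward_bound_accumulated(1)[OF order_refl assms]
    by (intro integral_mono integrable_exp_reward assms) (auto simp: abs_le_iff minus_le_iff)
  finally show ?thesis by (rule less_le_trans[rotated]) simp
qed

lemma expected_reward_eq_dyson_sum:
  assumes "0 \<le> t"
  shows "ennreal (expected_reward t) = ennreal (exp (- (\<beta> * t))) * dyson_sum P (\<lambda>y. ennreal (w y + \<beta>)) t x"
proof -
  have "ennreal (expected_reward t) = (\<integral>\<^sup>+\<omega>. ennreal (exp (- (\<beta> * (t - 0)))) * ennreal_exp (accumulated 0 t \<omega>) \<partial>M)"
    unfolding expected_reward_eq_nn_integral[OF assms]
    by (intro nn_integral_cong exp_reward order_refl assms)
  then show ?thesis by (simp add: nn_integral_cmult dyson_sum_eq[OF assms])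
qed

text \<open>
  The function that multiplies the exponential reward on the right is the expected reward over a time
  \<open>t\<close> for the process started at \<open>X\<^sub>a\<close>, expressed through the Dyson series (see
  \<open>expected_reward_eq_dyson_sum\<close>) because each starting point has its own law.
\<close>

lemma expected_reward_add:
  assumes a: "0 \<le> a" and t: "0 \<le> t"
  shows "ennreal (expected_reward (a + t)) = (\<integral>\<^sup>+\<omega>. ennreal (exp (reward 0 a \<omega>)) *
     (ennreal (exp (- (\<beta> * t))) * dyson_sum P (\<lambda>y. ennreal (w y + \<beta>)) t (X a \<omega>)) \<partial>M)"
proof -
  have at: "0 \<le> a + t" "a \<le> a + t" using assms by auto
  have [measurable]: "dyson_sum P (\<lambda>y. ennreal (w y + \<beta>)) t \<in> borel_measurable borel"
    by (rule measurable_dyson_sum[OF transition]) measurable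
  have [measurable]: "X a \<in> M \<rightarrow>\<^sub>M borel" using a by simp
  let ?e = "ennreal (exp (- (\<beta> * a))) * ennreal (exp (- (\<beta> * t)))"
  have "ennreal (exp (reward 0 (a + t) \<omega>)) =
      ?e * (ennreal_exp (accumulated 0 a \<omega>) * ennreal_exp (accumulated a (a + t) \<omega>))" if "\<omega> \<in> space M" for \<omega>
    using exp_reward[OF order_refl a that] exp_reward[OF a at(2) that]
    by (simp add: reward_add[OF a at(2) that] exp_add ennreal_mult' ac_simps)
  then have "ennreal (expected_reward (a + t)) =
      (\<integral>\<^sup>+\<omega>. ?e * (ennreal_exp (accumulated 0 a \<omega>) * ennreal_exp (accumulated a (a + t) \<omega>)) \<partial>M)"
    unfolding expected_reward_eq_nn_integral[OF at(1)] by (intro nn_integral_cong)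
  also have "\<dots> = ?e * (\<integral>\<^sup>+\<omega>. ennreal_exp (accumulated 0 a \<omega>) * dyson_sum P (\<lambda>y. ennreal (w y + \<beta>)) (a + t - a) (X a \<omega>) \<partial>M)"
    unfolding nn_integral_exp_accumulated_split[OF a at(2), symmetric] by (rule nn_integral_cmult) measurable
  also have "\<dots> = (\<integral>\<^sup>+\<omega>. ?e * (ennreal_exp (accumulated 0 a \<omega>) * dyson_sum P (\<lambda>y. ennreal (w y + \<beta>)) t (X a \<omega>)) \<partial>M)"
    by (simp add: nn_integral_cmult)
  also have "\<dots> = (\<integral>\<^sup>+\<omega>. ennreal (exp (reward 0 a \<omega>)) *
     (ennreal (exp (- (\<beta> * t))) * dyson_sum P (\<lambda>y. ennreal (w y + \<beta>)) t (X a \<omega>)) \<partial>M)"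
    using exp_reward[OF order_refl a] by (intro nn_integral_cong) (simp add: ac_simps)
  finally show ?thesis .
qed

text \<open>
  Growth rates along integer times thus carry over to real times.
\<close>

lemma ln_expected_reward_diff:
  assumes a: "0 \<le> a" "a \<le> t"
  shows "\<bar>ln (expected_reward t) - ln (expected_reward a)\<bar> \<le> \<beta> * (t - a)"
proof -
  have t: "0 \<le> t" using a by simp
  let ?e = "exp (\<beta> * (t - a))"
  have rew: "reward 0 t \<omega> \<le> \<beta> * (t - a) + reward 0 a \<omega>" "reward 0 a \<omega> \<le> \<beta> * (t - a) + reward 0 t \<omega>" if "\<omega> \<in> space M" for \<omega>
    using reward_bound_accumulated(1)[OF a that] reward_add[OF a that] by auto
  have "expected_reward t \<le> (LINT \<omega>|M. ?e * exp (reward 0 a \<omega>))"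
    unfolding expected_reward_def using rew
    by (intro integral_mono integrable_mult_right integrable_exp_reward t a) (auto simp flip: exp_add)
  then have "expected_reward t \<le> ?e * expected_reward a" by (simp add: expected_reward_def)
  then have "ln (expected_reward t) \<le> ln (?e * expected_reward a)"
    using expected_reward_pos[OF t] by (rule ln_mono)
  moreover have "expected_reward a \<le> (LINT \<omega>|M. ?e * exp (reward 0 t \<omega>))"
    unfolding expected_reward_def using rew
    by (intro integral_mono integrable_mult_right integrable_exp_reward t a) (auto simp flip: exp_add)
  then have "expected_reward a \<le> ?e * expected_reward t" by (simp add: expected_reward_def)
  then have "ln (expected_reward a) \<le> ln (?e * expected_reward t)"
    using expected_reward_pos[OF a(1)] by (rule ln_mono)
  ultimately show ?thesis
    using expected_reward_pos[OF t] expected_reward_pos[OF a(1)] by (simp add: ln_mult)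
qed

end

text \<open>
  Under this measure, expectations weighted by \<open>exp W\<close> become integrals over the state space; both weighted
  laws of the variation convergence have this form.
\<close>

lemma weighted_law:
  fixes Z :: "'w \<Rightarrow> 'e::topological_space"
  assumes "prob_space M" and [measurable]: "W \<in> borel_measurable M" "Z \<in> M \<rightarrow>\<^sub>M borel"
    and W: "\<forall>\<omega>\<in>space M. W \<omega> \<le> b"
  defines "\<mu> \<equiv> distr (density M (\<lambda>\<omega>. ennreal (exp (W \<omega>)))) borel Z"
  shows "finite_measure \<mu>" "sets \<mu> = sets borel"
    "B \<in> sets borel \<Longrightarrow> measure \<mu> B = (LINT \<omega>|M. exp (W \<omega>) * indicator B (Z \<omega>))"
    "f \<in> borel_measurable borel \<Longrightarrow> (\<integral>\<^sup>+y. f y \<partial>\<mu>) = (\<integral>\<^sup>+\<omega>. ennreal (exp (W \<omega>)) * f (Z \<omega>) \<partial>M)"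
proof -
  interpret prob_space M by fact
  show sets: "sets \<mu> = sets borel" by (simp add: \<mu>_def)
  show nn: "(\<integral>\<^sup>+y. f y \<partial>\<mu>) = (\<integral>\<^sup>+\<omega>. ennreal (exp (W \<omega>)) * f (Z \<omega>) \<partial>M)" 
    if [measurable]: "f \<in> borel_measurable borel" for f
    unfolding \<mu>_def by (simp add: nn_integral_distr nn_integral_density)
  have em: "emeasure \<mu> B = (\<integral>\<^sup>+\<omega>. ennreal (exp (W \<omega>) * indicator B (Z \<omega>)) \<partial>M)" if [measurable]: "B \<in> sets borel" for B
    using nn[of "indicator B"] by (simp add: sets ennreal_mult' ennreal_indicator)
  show "finite_measure \<mu>"
  proof (rule finite_measureI)
    have "emeasure \<mu> UNIV \<le> (\<integral>\<^sup>+\<omega>. ennreal (exp b) \<partial>M)"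
      using W by (subst em) (auto intro!: nn_integral_mono simp del: nn_integral_const)
    also have "\<dots> < \<top>" by (simp add: emeasure_space_1)
    finally show "emeasure \<mu> (space \<mu>) \<noteq> \<infinity>" by (simp add: \<mu>_def)
  qed
  show "measure \<mu> B = (LINT \<omega>|M. exp (W \<omega>) * indicator B (Z \<omega>))" if [measurable]: "B \<in> sets borel"
    unfolding measure_def em[OF that] by (subst integral_eq_nn_integral) auto
qed

text \<open>
  A bounded deviation from a linear function of \<open>T\<close> disappears after division by \<open>T\<close>. The limit
  exists, so the sign of \<open>\<alpha>\<close> does not matter for the limit inferior.
\<close>

lemma Liminf_rate:
  fixes \<zeta> T :: "'i \<Rightarrow> real"
  assumes "F \<noteq> bot" and T: "filterlim T at_top F" and \<zeta>: "\<forall>\<^sub>F i in F. \<bar>\<zeta> i - T i * l\<bar> \<le> r"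
  shows "Liminf F (\<lambda>i. ereal (1 / \<alpha> * (1 / T i) * \<zeta> i)) = ereal (l / \<alpha>)"
proof -
  have "((\<lambda>i. (\<zeta> i - T i * l) / T i) \<longlongrightarrow> 0) F"
  proof (rule Lim_null_comparison)
    show "\<forall>\<^sub>F i in F. norm ((\<zeta> i - T i * l) / T i) \<le> r / T i"
      using \<zeta> filterlim_at_top_dense[THEN iffD1, OF T, rule_format, of 0]
      by eventually_elim (simp add: divide_right_mono)
    show "((\<lambda>i. r / T i) \<longlongrightarrow> 0) F"
      by (rule real_tendsto_divide_at_top[OF tendsto_const T])
  qed
  then have "((\<lambda>i. 1 / \<alpha> * ((\<zeta> i - T i * l) / T i + l)) \<longlongrightarrow> 1 / \<alpha> * (0 + l)) F"
    by (intro tendsto_intros)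
  moreover have "\<forall>\<^sub>F i in F. 1 / \<alpha> * ((\<zeta> i - T i * l) / T i + l) = 1 / \<alpha> * (1 / T i) * \<zeta> i"
    using filterlim_at_top_dense[THEN iffD1, OF T, rule_format, of 0]
    by eventually_elim (auto simp: field_simps)
  ultimately have "((\<lambda>i. 1 / \<alpha> * (1 / T i) * \<zeta> i) \<longlongrightarrow> l / \<alpha>) F"
    by (simp add: tendsto_cong)
  then show ?thesis using \<open>F \<noteq> bot\<close> by (intro lim_imp_Liminf) auto
qed

text \<open>
  The error bound \<open>r\<close> is common to all \<open>m\<close>, so a time \<open>n\<close> of order \<open>1 / e\<close> determines every slope
  up to \<open>e\<close>; at that single time the convergence \<open>z' m n \<rightarrow> z n\<close> is used.
\<close>

lemma rates_tendsto:
  fixes z :: "nat \<Rightarrow> real" and z' :: "nat \<Rightarrow> nat \<Rightarrow> real"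
  assumes z': "\<And>m n. \<bar>z' m n - real n * l' m\<bar> \<le> r" and z: "\<And>n. \<bar>z n - real n * l\<bar> \<le> r"
    and lim: "\<And>n. (\<lambda>m. z' m n) \<longlonglongrightarrow> z n"
  shows "l' \<longlonglongrightarrow> l"
proof (rule metric_LIMSEQ_I)
  fix e :: real assume "0 < e"
  define n where "n = Suc (nat \<lceil>(2 * r + 1) / e\<rceil>)"
  have n: "(2 * r + 1) / e < real n" unfolding n_def by linarith
  obtain N where N: "\<bar>z' m n - z n\<bar> < 1" if "N \<le> m" for m
    using metric_LIMSEQ_D[OF lim[of n], of 1] by (auto simp: dist_real_def)
  show "\<exists>N. \<forall>m\<ge>N. dist (l' m) l < e"
  proof (intro exI[of _ N] allI impI)
    fix m assume "N \<le> m"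
    have "real n * \<bar>l' m - l\<bar> = \<bar>real n * l' m - real n * l\<bar>"
      by (simp add: abs_mult flip: right_diff_distrib)
    also have "\<dots> < 2 * r + 1" using N[OF \<open>N \<le> m\<close>] z'[of m n] z[of n] by linarith
    also have "\<dots> < real n * e" using n \<open>0 < e\<close> by (simp add: field_simps)
    finally show "dist (l' m) l < e" by (simp add: dist_real_def n_def)
  qed
qed

section \<open>Convergence of the discretized functionals\<close>

theorem corollary6:
  fixes U :: "'a::topological_space set"
    and \<U> :: "('e::polish_space \<Rightarrow> 'a) set"
    and c :: "'e \<Rightarrow> 'a \<Rightarrow> real"
    and P :: "('e \<Rightarrow> 'a) \<Rightarrow> real \<Rightarrow> 'e \<Rightarrow> 'e measure"
    and Pr :: "('e \<Rightarrow> 'a) \<Rightarrow> 'e \<Rightarrow> 'w measure"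
    and X :: "('e \<Rightarrow> 'a) \<Rightarrow> real \<Rightarrow> 'w \<Rightarrow> 'e"
    and Q :: "nat \<Rightarrow> 'a \<Rightarrow> 'e \<Rightarrow> 'e measure"
    and PrD :: "nat \<Rightarrow> ('e \<Rightarrow> 'a) \<Rightarrow> 'e \<Rightarrow> 'v measure"
    and Y :: "nat \<Rightarrow> ('e \<Rightarrow> 'a) \<Rightarrow> nat \<Rightarrow> 'v \<Rightarrow> 'e"
    and \<alpha> :: real
  assumes compact: "compact U"
    and controls: "\<U> \<subseteq> borel \<rightarrow>\<^sub>M restrict_space borel U"
    and cost_bounded: "\<exists>C. \<forall>x. \<forall>a\<in>U. \<bar>c x a\<bar> \<le> C"
    and cost_measurable: "case_prod c \<in> borel \<Otimes>\<^sub>M restrict_space borel U \<rightarrow>\<^sub>M borel"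
    and cost_continuous: "\<And>x. continuous_on U (c x)"
    and transition: "\<And>u. u \<in> \<U> \<Longrightarrow>
      (\<lambda>(t, x). P u t x) \<in> restrict_space borel {0..} \<Otimes>\<^sub>M borel \<rightarrow>\<^sub>M prob_algebra borel"
    and process: "\<And>u x. u \<in> \<U> \<Longrightarrow> markov_process (P u) x (Pr u x) (X u)"
    and paths_measurable: "\<And>u x. u \<in> \<U> \<Longrightarrow>
      (\<lambda>(t, \<omega>). X u t \<omega>) \<in> restrict_space borel {0..} \<Otimes>\<^sub>M Pr u x \<rightarrow>\<^sub>M borel"
    and kernel: "\<And>m a. a \<in> U \<Longrightarrow> Q m a \<in> borel \<rightarrow>\<^sub>M prob_algebra borel"
    and kernel_control: "\<And>m u. u \<in> \<U> \<Longrightarrow> controlled_kernel Q m u \<in> borel \<rightarrow>\<^sub>M prob_algebra borel"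
    and chain: "\<And>m u x. u \<in> \<U> \<Longrightarrow>
      markov_process (kernel_power (controlled_kernel Q m u)) x (PrD m u x) (Y m u)"
    and alpha: "\<alpha> \<noteq> 0"
    and eConv: "eConv \<alpha> c \<U> Pr X PrD Y"
    and uUE: "uUE \<U> Q"
    and uEquiv: "uEquiv \<U> Q"
  shows "\<forall>u\<in>\<U>. \<forall>x.
    (\<lambda>m. I_disc \<alpha> c (1 / 2 ^ m) u (PrD m u x) (Y m u)) \<longlonglongrightarrow> I_cont \<alpha> c u (Pr u x) (X u)"
proof (intro ballI allI)
  fix u x assume u: "u \<in> \<U>"
  then have um: "u \<in> borel \<rightarrow>\<^sub>M restrict_space borel U" using controls by auto
  then have uU: "u y \<in> U" for y using measurable_space[OF um, of y] by (simp add: space_restrict_space)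
  obtain C where C: "\<And>y a. a \<in> U \<Longrightarrow> \<bar>c y a\<bar> \<le> C" using cost_bounded by blast
  define w where "w y = \<alpha> * c y (u y)" for y
  define \<beta> where "\<beta> = \<bar>\<alpha>\<bar> * C"
  have wb: "\<bar>w y\<bar> \<le> \<beta>" for y
    unfolding w_def \<beta>_def abs_mult using C[OF uU] by (intro mult_left_mono) auto
  have "(\<lambda>y. (y, u y)) \<in> borel \<rightarrow>\<^sub>M borel \<Otimes>\<^sub>M restrict_space borel U"
    using um by (intro measurable_Pair) auto
  from measurable_compose[OF this cost_measurable]
  have wm[measurable]: "w \<in> borel_measurable borel" by (simp add: w_def[abs_def])
  define h :: "nat \<Rightarrow> real" where "h m = 1 / 2 ^ m" for m
  have h: "0 < h m" for m by (simp add: h_def)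

  interpret cont: bounded_additive_functional "P u" y "Pr u y" "X u" w \<beta> for y
    using u transition process paths_measurable wb by unfold_locales auto
  interpret disc: tilted_kernel "controlled_kernel Q m u" "\<lambda>y. h m * w y" "h m * \<beta>" for m
    using u kernel_control wb h by unfold_locales (auto simp: abs_mult abs_of_pos intro!: mult_left_mono less_imp_le)
  define Z where "Z t y = cont.expected_reward y t" for t y
  define G where "G m n y = disc.mass m n y" for m n y

  \<comment> \<open>The weighted laws over one unit of time, realized as measures on the state space.\<close>
  define \<mu> where "\<mu> m y = distr (density (PrD m u y) (\<lambda>\<omega>. ennreal (exp (\<Sum>i<2 ^ m. h m * w (Y m u i \<omega>))))) borel (Y m u (2 ^ m))" for m y
  define \<nu> where "\<nu> y = distr (density (Pr u y) (\<lambda>\<omega>. ennreal (exp (cont.reward 0 1 \<omega>)))) borel (X u 1)" for y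
  have prob: "prob_space (PrD m u y)" "prob_space (Pr u y)" for m y
    using chain[OF u] process[OF u] by (auto simp: markov_process_def)
  have Ym[measurable]: "Y m u i \<in> PrD m u y \<rightarrow>\<^sub>M borel" for m i y
    using chain[OF u, of m y] by (simp add: markov_process_def)
  have Wm: "(\<lambda>\<omega>. \<Sum>i<n. h m * w (Y m u i \<omega>)) \<in> borel_measurable (PrD m u y)" for m n y
    by measurable
  have Wb: "\<forall>\<omega>\<in>space (PrD m u y). (\<Sum>i<2 ^ m. h m * w (Y m u i \<omega>)) \<le> \<beta>" for m y
  proof
    fix \<omega>
    have "(\<Sum>i<2 ^ m. h m * w (Y m u i \<omega>)) \<le> (\<Sum>i<(2::nat) ^ m. h m * \<beta>)"
      using wb h by (intro sum_mono mult_left_mono) (auto simp: abs_le_iff less_imp_le)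
    also have "\<dots> = \<beta>" by (simp add: h_def)
    finally show "(\<Sum>i<2 ^ m. h m * w (Y m u i \<omega>)) \<le> \<beta>" .
  qed
  have Rb: "\<forall>\<omega>\<in>space (Pr u y). cont.reward 0 1 \<omega> \<le> \<beta>" for y
    using cont.reward_bound_accumulated(1)[of 0 1 _ y] by fastforce
  note \<mu> = weighted_law[OF prob(1) Wm Ym[of m "2 ^ m" for m] Wb, folded \<mu>_def]
  {
    fix y
    have "(0::real) \<le> 0" "(0::real) \<le> 1" by auto
    note weighted_law[OF prob(2)[of y] cont.measurable_reward[OF this, of y] cont.measurable_state[OF this(2), of y]
      Rb[of y], folded \<nu>_def]
  } note \<nu> = this
  have wd: "weighted_disc \<alpha> c m u (PrD m u y) (Y m u) B = measure (\<mu> m y) B" if "B \<in> sets borel" for m y B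
    unfolding weighted_disc_def \<mu>(3)[OF that]
    by (simp add: w_def h_def sum_distrib_left ac_simps)
  have wc: "weighted_cont \<alpha> c u (Pr u y) (X u) B = measure (\<nu> y) B" if "B \<in> sets borel" for y B
    unfolding weighted_cont_def \<nu>(3)[OF that] cont.reward_def w_def by simp
  have var: "(\<lambda>m. variation_norm (\<lambda>B. measure (\<mu> m y) B - measure (\<nu> y) B)) \<longlonglongrightarrow> 0" for y
  proof -
    have "variation_norm (\<lambda>B. weighted_disc \<alpha> c m u (PrD m u y) (Y m u) B - weighted_cont \<alpha> c u (Pr u y) (X u) B) =
      variation_norm (\<lambda>B. measure (\<mu> m y) B - measure (\<nu> y) B)" for m
      unfolding variation_norm_def by (intro SUP_cong sum.cong refl) (auto simp: wd wc)
    moreover have "(\<lambda>m. variation_norm (\<lambda>B. weighted_disc \<alpha> c m u (PrD m u y) (Y m u) B -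
        weighted_cont \<alpha> c u (Pr u y) (X u) B)) \<longlonglongrightarrow> 0"
      using eConv u unfolding eConv_def by blast
    ultimately show ?thesis by (simp only:)
  qed

  have lim: "(\<lambda>m. G m (n * 2 ^ m) y) \<longlonglongrightarrow> ennreal (Z (real n) y)" for n y
  proof (induction n arbitrary: y)
    case 0
    have "Z 0 y = 1"
      using prob_space.prob_space[OF prob(2)] cont.reward_bound_accumulated(1)[of 0 0 _ y]
      by (simp add: Z_def cont.expected_reward_def cong: Bochner_Integration.integral_cong)
    then show ?case by (simp add: G_def disc.mass_def)
  next
    case (Suc n)
    \<comment> \<open>The Dyson series form of \<open>Z\<close> provides its measurability in the starting point.\<close>
    define H where "H y = ennreal (exp (- (\<beta> * real n))) * dyson_sum (P u) (\<lambda>y. ennreal (w y + \<beta>)) (real n) y" for y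
    have Hm[measurable]: "H \<in> borel_measurable borel"
      unfolding H_def using measurable_dyson_sum[OF transition[OF u]] by measurable
    have H: "ennreal (Z (real n) y) = H y" for y
      unfolding Z_def H_def by (rule cont.expected_reward_eq_dyson_sum) simp
    have "(\<lambda>m. \<integral>\<^sup>+z. G m (n * 2 ^ m) z \<partial>\<mu> m y) \<longlonglongrightarrow> (\<integral>\<^sup>+z. H z \<partial>\<nu> y)"
    proof (rule nn_integral_tendsto_variation[OF \<mu>(1) \<nu>(1) \<mu>(2) \<nu>(2) var])
      show "G m (n * 2 ^ m) \<in> borel_measurable borel" for m
        unfolding G_def by measurable
      show "G m (n * 2 ^ m) z \<le> ennreal (exp (real n * \<beta>))" for m z
        using disc.mass_bounds(1)[of m "n * 2 ^ m" z] by (simp add: G_def h_def)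
      show "(\<lambda>m. G m (n * 2 ^ m) z) \<longlonglongrightarrow> H z" for z
        using Suc.IH[of z] unfolding H .
    qed measurable
    moreover have "(\<integral>\<^sup>+z. G m (n * 2 ^ m) z \<partial>\<mu> m y) = G m (Suc n * 2 ^ m) y" for m
      unfolding G_def unfolding \<mu>(4)[OF disc.measurable_mass]
      by (simp add: disc.nn_integral_chain[OF chain[OF u]] disc.mass_add)
    moreover have "(\<integral>\<^sup>+z. H z \<partial>\<nu> y) = ennreal (Z (real (Suc n)) y)"
      unfolding \<nu>(4)[OF Hm] unfolding Z_def H_def using cont.expected_reward_add[of 1 "real n" y] by simp
    ultimately show ?case by simp
  qed

  obtain k \<kappa> where \<kappa>: "\<And>m y y' B. B \<in> sets borel \<Longrightarrow>
      measure (kernel_power (controlled_kernel Q m u) (k * 2 ^ m) y) B \<le>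
      \<kappa> * measure (kernel_power (controlled_kernel Q m u) (k * 2 ^ m) y') B"
    using uEquiv u unfolding uEquiv_def discrete_transition_def by metis
  \<comment> \<open>The comparison takes \<open>k 2\<^sup>m\<close> steps, each tilted by at most \<open>\<beta> / 2\<^sup>m\<close>, so \<open>r\<close> does not depend on \<open>m\<close>.\<close>
  define r where "r = ln (\<kappa> * exp (2 * (real k * \<beta>)))"
  define \<zeta> where "\<zeta> m n = ln (enn2real (G m n x))" for m n
  have hN: "real (n * 2 ^ m) * (h m * \<beta>) = real n * \<beta>" for n m
    by (simp add: h_def)
  have \<zeta>add: "\<bar>\<zeta> m (n + j) - \<zeta> m n - \<zeta> m j\<bar> \<le> r" for m n j
    using disc.ln_mass_almost_additive[OF \<kappa>, of m n j x] unfolding hN \<zeta>_def r_def G_def .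
  have "\<exists>l. \<forall>n. \<bar>\<zeta> m n - real n * l\<bar> \<le> r" for m
    using almost_additive_linear[of "\<zeta> m", OF \<zeta>add] by metis
  then obtain l where l: "\<And>m n. \<bar>\<zeta> m n - real n * l m\<bar> \<le> r" by metis
  have lh: "\<bar>\<zeta> m (n * 2 ^ m) - real n * (l m / h m)\<bar> \<le> r" for m n
    using l[of m "n * 2 ^ m"] by (simp add: h_def ac_simps)
  define z where "z t = ln (Z t x)" for t
  have Zpos: "0 < Z t x" if "0 \<le> t" for t unfolding Z_def using cont.expected_reward_pos[OF that] .
  have \<zeta>lim: "(\<lambda>m. \<zeta> m (n * 2 ^ m)) \<longlonglongrightarrow> z (real n)" for n
  proof -
    have "(\<lambda>m. enn2real (G m (n * 2 ^ m) x)) \<longlonglongrightarrow> enn2real (ennreal (Z (real n) x))"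
      using lim[of n x] Zpos[of "real n"] by (intro tendsto_enn2real) auto
    then show ?thesis unfolding \<zeta>_def z_def using Zpos[of "real n"] by (intro tendsto_ln) auto
  qed
  have "\<bar>z (real (n + j)) - z (real n) - z (real j)\<bar> \<le> r" for n j
  proof (rule tendsto_upperbound)
    show "(\<lambda>m. \<bar>\<zeta> m ((n + j) * 2 ^ m) - \<zeta> m (n * 2 ^ m) - \<zeta> m (j * 2 ^ m)\<bar>) \<longlonglongrightarrow>
        \<bar>z (real (n + j)) - z (real n) - z (real j)\<bar>"
      by (intro tendsto_intros \<zeta>lim)
  qed (use \<zeta>add in \<open>auto simp: add_mult_distrib\<close>)
  then obtain \<Lambda> where \<Lambda>: "\<And>n. \<bar>z (real n) - real n * \<Lambda>\<bar> \<le> r"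
    using almost_additive_linear[of "\<lambda>n. z (real n)"] by metis
  have rates: "(\<lambda>m. l m / h m) \<longlonglongrightarrow> \<Lambda>"
    by (rule rates_tendsto[OF lh \<Lambda> \<zeta>lim])

  have disc_limit: "I_disc \<alpha> c (1 / 2 ^ m) u (PrD m u x) (Y m u) = ereal (l m / h m / \<alpha>)" for m
  proof -
    have "(LINT \<omega>|PrD m u x. exp (\<alpha> * (1 / 2 ^ m) * (\<Sum>i<n. c (Y m u i \<omega>) (u (Y m u i \<omega>))))) = enn2real (G m n x)" for n
    proof -
      have "(LINT \<omega>|PrD m u x. exp (\<alpha> * (1 / 2 ^ m) * (\<Sum>i<n. c (Y m u i \<omega>) (u (Y m u i \<omega>))))) =
        (LINT \<omega>|PrD m u x. exp (\<Sum>i<n. h m * w (Y m u i \<omega>)))"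
        by (simp add: w_def h_def sum_distrib_left ac_simps)
      also have "\<dots> = enn2real (\<integral>\<^sup>+\<omega>. ennreal (exp (\<Sum>i<n. h m * w (Y m u i \<omega>))) \<partial>PrD m u x)"
        by (intro integral_eq_nn_integral) (use Wm in auto)
      also have "\<dots> = enn2real (G m n x)"
        using disc.nn_integral_chain[OF chain[OF u, of m x], where f = "\<lambda>_. 1" and n = n] by (simp add: G_def disc.mass_def)
      finally show ?thesis .
    qed
    then have "I_disc \<alpha> c (1 / 2 ^ m) u (PrD m u x) (Y m u) =
      liminf (\<lambda>n. ereal (1 / \<alpha> * (1 / (real n * h m)) * \<zeta> m n))"
      by (simp add: I_disc_def \<zeta>_def h_def)
    also have "\<dots> = ereal (l m / h m / \<alpha>)"
    proof (rule Liminf_rate)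
      show "filterlim (\<lambda>n. real n * h m) at_top sequentially"
        using h by (intro filterlim_at_top_mult_tendsto_pos[OF tendsto_const] filterlim_real_sequentially) 
      show "\<forall>\<^sub>F n in sequentially. \<bar>\<zeta> m n - real n * h m * (l m / h m)\<bar> \<le> r"
        using l[of m] h[of m] by simp
    qed simp
    finally show ?thesis .
  qed
  have cont_limit: "I_cont \<alpha> c u (Pr u x) (X u) = ereal (\<Lambda> / \<alpha>)"
  proof -
    have "I_cont \<alpha> c u (Pr u x) (X u) = Liminf at_top (\<lambda>t. ereal (1 / \<alpha> * (1 / t) * z t))"
      by (simp add: I_cont_def z_def Z_def cont.expected_reward_def cont.reward_def w_def)
    also have "\<dots> = ereal (\<Lambda> / \<alpha>)"
    proof (rule Liminf_rate)
      show "\<forall>\<^sub>F t in at_top. \<bar>z t - t * \<Lambda>\<bar> \<le> r + \<beta> + \<bar>\<Lambda>\<bar>"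
      proof (rule eventually_at_top_linorderI)
        fix t :: real assume t: "0 \<le> t"
        define n where "n = nat \<lfloor>t\<rfloor>"
        have n: "real n \<le> t" "t - real n \<le> 1" using t unfolding n_def by linarith+
        have "\<beta> * (t - real n) \<le> \<beta> * 1" using n wb[of undefined] by (intro mult_left_mono) auto
        then have "\<bar>z t - z (real n)\<bar> \<le> \<beta>"
          using cont.ln_expected_reward_diff[of "real n" t x] n unfolding z_def Z_def by auto
        moreover have "\<bar>real n * \<Lambda> - t * \<Lambda>\<bar> \<le> \<bar>\<Lambda>\<bar>"
          using n mult_right_mono[of "\<bar>real n - t\<bar>" 1 "\<bar>\<Lambda>\<bar>"] by (simp add: abs_mult flip: left_diff_distrib)
        ultimately show "\<bar>z t - t * \<Lambda>\<bar> \<le> r + \<beta> + \<bar>\<Lambda>\<bar>" using \<Lambda>[of n] by linarith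
      qed
    qed (auto simp: filterlim_ident)
    finally show ?thesis .
  qed
  show "(\<lambda>m. I_disc \<alpha> c (1 / 2 ^ m) u (PrD m u x) (Y m u)) \<longlonglongrightarrow> I_cont \<alpha> c u (Pr u x) (X u)"
    unfolding disc_limit cont_limit using rates alpha by (intro tendsto_intros) auto
qed

end
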